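(* Let $\mathcal{H}_1\to\mathcal{H}_2$ be an isogeny of affine Hecke algebras, let $E:\mathcal{H}_2\to\mathcal{H}_1$ be the projection onto the degree-zero component $\mathcal{H}_{2,0}=\mathcal{H}_1$ of the $X_2/X_1$-grading of $\mathcal{H}_2$, and let $V$ be an $\mathcal{H}_1$-module. The pairing $$\mathrm{Ind}_{\mathcal{H}_1}^{\mathcal{H}_2}(V^\dagger)\times\mathrm{Ind}_{\mathcal{H}_1}^{\mathcal{H}_2}V\to\mathbb{C},\qquad \langle h'\otimes\mu,\ h\otimes v\rangle=(E(h^*h')\mu)(v)$$ induces an isomorphism of $\mathcal{H}_2$-modules $\mathrm{Ind}_{\mathcal{H}_1}^{\mathcal{H}_2}(V^\dagger)\cong(\mathrm{Ind}_{\mathcal{H}_1}^{\mathcal{H}_2}V)^\dagger$.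
   Context: Affine Hecke algebras. Let $\mathcal{R} = (X,R,Y,R^\vee,\Delta)$ be a reduced based root datum ($X,Y$ free abelian of finite rank in perfect duality $\langle\cdot,\cdot\rangle$, $\Delta\subset R$ a base of simple roots), with finite Weyl group $W$, longest element $w_0\in W$ and simple reflections $s_\alpha$, $\alpha\in\Delta$. Fix $q\in\mathbb{R}_{>1}$ and parameter functions $\lambda,\lambda^*: R\to\mathbb{R}\setminus\{0\}$, constant on orbits of $W\ltimes X$ (acting on $R$ through $W$), with $\lambda(\alpha)=\lambda^*(\alpha)$ if $\alpha^\vee\notin 2Y$ and $\lambda(\alpha)+\lambda^*(\alpha)\neq 0$ if $\alpha^\vee\in 2Y$. The affine Hecke algebra $\mathcal{H}=\mathcal{H}(\mathcal{R})$ is the $\mathbb{C}$-algebra with linear basis $\theta_xT_w$ ($x\in X$, $w\in W$) and relations: $T_wT_{w'}=T_{ww'}$ if $\ell(ww')=\ell(w)+\ell(w')$; $(T_{s_\alpha}+1)(T_{s_\alpha}-q^{\lambda(\alpha)})=0$ for $\alpha\in\Delta$; $\theta_x\theta_y=\theta_{x+y}$; and, for $s=s_\alpha$, $\alpha\in\Delta$, $T_s\theta_x=\theta_{s(x)}T_s+(q^{\lambda(\alpha)}-1)\frac{\theta_x-\theta_{s(x)}}{1-\theta_{-\alpha}}$ if $\alpha^\vee\notin 2Y$, and $T_s\theta_x=\theta_{s(x)}T_s+\big((q^{\lambda(\alpha)}-1)+\theta_{-\alpha}(q^{(\lambda(\alpha)+\lambda^*(\alpha))/2}-q^{(\lambda(\alpha)-\lambda^*(\alpha))/2})\big)\frac{\theta_x-\theta_{s(x)}}{1-\theta_{-2\alpha}}$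 if $\alpha^\vee\in 2Y$. Star operation. $*:\mathcal{H}\to\mathcal{H}$ is the conjugate-linear anti-automorphism with $T_w^*=T_{w^{-1}}$ ($w\in W$) and $\theta_x^*=T_{w_0}\theta_{-w_0(x)}T_{w_0}^{-1}$ ($x\in X$). For an $\mathcal{H}$-module $V$, the hermitian dual is $V^\dagger=\mathrm{Hom}_{\mathbb{C}}(\overline V,\mathbb{C})$ (conjugate-linear functionals on $V$) with action $(h\mu)(v)=\mu(h^*v)$. Isogenies. An isogeny of based root data $(X_1,R_1,Y_1,R_1^\vee,\Delta_1)\to(X_2,R_2,Y_2,R_2^\vee,\Delta_2)$ is an injective group homomorphism $f:X_1\to X_2$ with finite cokernel that restricts to an isomorphism of based root systems $(\mathbb{R}R_1,R_1,\mathbb{R}R_1^\vee,R_1^\vee,\Delta_1)\to(\mathbb{R}R_2,R_2,\mathbb{R}R_2^\vee,R_2^\vee,\Delta_2)$, where the transpose $f^\vee:Y_2\to Y_1$ sends $f(\alpha)^\vee$ to $\alpha^\vee$ for all $\alpha\in R_1$ (so Weyl groups are identified and $f$ is $W$-equivariant). If the parameters are compatible (same $q$, $\lambda_2\circ f=\lambda_1$, $\lambda_2^*\circ f=\lambda_1^*$ on $R_1$), it induces an injective algebra homomorphism $\mathcal{H}_1=\mathcal{H}(\mathcal{R}_1)\to\mathcal{H}_2=\mathcal{H}(\mathcal{R}_2)$, $\theta_xT_w\mapsto\theta_{f(x)}T_w$, called an isogeny of affine Hecke algebras; $\mathcal{H}_1,X_1$ are identified with their images. $\mathrm{Ind}_{\mathcal{H}_1}^{\mathcal{H}_2}V=\mathcal{H}_2\otimes_{\mathcal{H}_1}V$.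 The grading is $\mathcal{H}_2=\bigoplus_{g\in X_2/X_1}\mathcal{H}_{2,g}$ with $\mathcal{H}_{2,g}=\mathrm{span}\{\theta_xT_w: x\in X_2,\ x+X_1=g,\ w\in W\}$, and $\mathcal{H}_{2,0}=\mathcal{H}_1$. *)

theory Defs
  imports
    Complex_Main
    "HOL-Library.FuncSet"
    "HOL-Algebra.Module"
    "HOL-Algebra.Free_Abelian_Groups"
begin

section \<open>Lattices\<close>

definition zscale :: "int \<Rightarrow> 'a::ab_group_add \<Rightarrow> 'a" where
  "zscale k x = (if 0 \<le> k then (\<Sum>i<nat k. x) else - (\<Sum>i<nat (- k). x))"

lemma zscale_of_nat: "zscale (int n) x = (\<Sum>i<n. x)"
  by (simp add: zscale_def)

lemma zscale_minus: "zscale (- k) x = - zscale k x"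
  by (auto simp: zscale_def)

lemma zscale_plus_one: "zscale (k + 1) x = zscale k x + x"
proof (cases "0 \<le> k")
  case True
  then obtain n where "k = int n" by (metis nonneg_int_cases)
  moreover have "zscale (int n + 1) x = zscale (int (Suc n)) x" by (simp add: ac_simps)
  ultimately show ?thesis by (simp only: zscale_of_nat sum.lessThan_Suc)
next
  case False
  then obtain n where n: "k = - int (Suc n)"
    by (metis int_cases of_nat_0_le_iff)
  then have "zscale (k + 1) x = - zscale (int n) x"
    by (simp flip: zscale_minus)
  moreover have "zscale k x = - zscale (int (Suc n)) x"
    by (simp only: n zscale_minus)
  ultimately show ?thesis
    by (simp only: zscale_of_nat sum.lessThan_Suc) simp
qed

lemma zscale_add_left: "zscale (k + l) x = zscale k x + zscale l x"
proof (induction l rule: int_induct[where k = 0])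
  case base
  show ?case by (simp add: zscale_def)
next
  case (step1 i)
  then show ?case by (simp add: zscale_plus_one flip: add.assoc)
next
  case (step2 i)
  then show ?case
    using zscale_plus_one[of "k + i - 1" x] zscale_plus_one[of "i - 1" x]
    by (simp add: algebra_simps)
qed

lemma zscale_add_right: "zscale k (x + y) = zscale k x + zscale k y"
  by (simp add: zscale_def sum.distrib)

lemma zscale_one: "zscale 1 x = x"
  by (simp add: zscale_def)

lemma zscale_zscale: "zscale k (zscale l x) = zscale (k * l) x"
proof (induction k rule: int_induct[where k = 0])
  case base
  show ?case by (simp add: zscale_def)
next
  case (step1 i)
  then show ?case by (simp add: zscale_plus_one zscale_add_left zscale_one distrib_right)
next
  case (step2 i)
  then show ?case
    using zscale_plus_one[of "i - 1" "zscale l x"] zscale_add_left[of "(i - 1) * l" l x]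
    by (simp add: algebra_simps)
qed

global_interpretation int_module: Modules.module zscale
  by standard (simp_all add: zscale_add_left zscale_add_right zscale_zscale zscale_one)

definition free_of_finite_rank :: "'a::ab_group_add itself \<Rightarrow> bool" where
  "free_of_finite_rank _ \<longleftrightarrow>
     (\<exists>B::'a set. finite B \<and> int_module.independent B \<and> int_module.span B = UNIV)"

definition perfect_pairing :: "('x::ab_group_add \<Rightarrow> 'y::ab_group_add \<Rightarrow> int) \<Rightarrow> bool" where
  "perfect_pairing p \<longleftrightarrow>
     (\<forall>x. additive (p x)) \<and> (\<forall>y. additive (\<lambda>x. p x y)) \<and>
     (\<forall>\<phi>. additive \<phi> \<longrightarrow> (\<exists>!x. \<phi> = p x)) \<and>
     (\<forall>\<phi>. additive \<phi> \<longrightarrow> (\<exists>!y. \<phi> = (\<lambda>x. p x y)))"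


section \<open>Based root data\<close>

text \<open>The lattices \<open>X\<close> and \<open>Y\<close> are the types \<open>'x\<close> and \<open>'y\<close>; the set of coroots is the
  image of \<open>roots\<close> under \<open>coroot\<close>, and \<open>coroot\<close> is irrelevant outside \<open>roots\<close>.\<close>

record ('x, 'y) root_datum =
  pairing :: "'x \<Rightarrow> 'y \<Rightarrow> int"
  roots :: "'x set"
  coroot :: "'x \<Rightarrow> 'y"
  simple_roots :: "'x set"

definition reflection :: "('x::ab_group_add, 'y) root_datum \<Rightarrow> 'x \<Rightarrow> 'x \<Rightarrow> 'x" where
  "reflection D \<alpha> x = x - zscale (pairing D x (coroot D \<alpha>)) \<alpha>"

definition coreflection :: "('x, 'y::ab_group_add) root_datum \<Rightarrow> 'x \<Rightarrow> 'y \<Rightarrow> 'y" where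
  "coreflection D \<alpha> y = y - zscale (pairing D \<alpha> y) (coroot D \<alpha>)"

locale based_root_datum =
  fixes D :: "('x::ab_group_add, 'y::ab_group_add) root_datum"
  assumes free_X: "free_of_finite_rank TYPE('x)"
    and free_Y: "free_of_finite_rank TYPE('y)"
    and perfect: "perfect_pairing (pairing D)"
    and finite_roots: "finite (roots D)"
    and inj_coroot: "inj_on (coroot D) (roots D)"
    and pairing_coroot: "\<alpha> \<in> roots D \<Longrightarrow> pairing D \<alpha> (coroot D \<alpha>) = 2"
    and reflection_roots: "\<alpha> \<in> roots D \<Longrightarrow> reflection D \<alpha> ` roots D = roots D"
    and coreflection_coroots:
      "\<alpha> \<in> roots D \<Longrightarrow> coreflection D \<alpha> ` coroot D ` roots D = coroot D ` roots D"
    and reduced: "\<lbrakk>\<alpha> \<in> roots D; \<beta> \<in> roots D; m \<noteq> 0; zscale m \<alpha> = zscale n \<beta>\<rbrakk> \<Longrightarrow> \<beta> = \<alpha> \<or> \<beta> = - \<alpha>"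
    and simple_subset: "simple_roots D \<subseteq> roots D"
    and simple_independent: "int_module.independent (simple_roots D)"
    and simple_base: "\<alpha> \<in> roots D \<Longrightarrow>
      \<exists>c. \<alpha> = (\<Sum>\<delta>\<in>simple_roots D. zscale (c \<delta>) \<delta>) \<and>
          ((\<forall>\<delta>\<in>simple_roots D. 0 \<le> c \<delta>) \<or> (\<forall>\<delta>\<in>simple_roots D. c \<delta> \<le> 0))"

text \<open>The Weyl group, as a group of automorphisms of \<open>X\<close>. Reflections are involutions, so the
  monoid they generate is already a group.\<close>

inductive_set weyl :: "('x::ab_group_add, 'y) root_datum \<Rightarrow> ('x \<Rightarrow> 'x) set"
  for D :: "('x, 'y) root_datum" where
  weyl_id: "id \<in> weyl D"
| weyl_reflection: "\<lbrakk>\<alpha> \<in> roots D; w \<in> weyl D\<rbrakk> \<Longrightarrow> reflection D \<alpha> \<circ> w \<in> weyl D"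

definition weyl_length :: "('x::ab_group_add, 'y) root_datum \<Rightarrow> ('x \<Rightarrow> 'x) \<Rightarrow> nat" where
  "weyl_length D w =
     (LEAST n. \<exists>as. length as = n \<and> set as \<subseteq> simple_roots D \<and> w = foldr (\<circ>) (map (reflection D) as) id)"

definition is_longest :: "('x::ab_group_add, 'y) root_datum \<Rightarrow> ('x \<Rightarrow> 'x) \<Rightarrow> bool" where
  "is_longest D w \<longleftrightarrow> w \<in> weyl D \<and> (\<forall>v\<in>weyl D. weyl_length D v \<le> weyl_length D w)"

definition coroot_even :: "('x, 'y::ab_group_add) root_datum \<Rightarrow> 'x \<Rightarrow> bool" where
  "coroot_even D \<alpha> \<longleftrightarrow> coroot D \<alpha> \<in> range (\<lambda>y. y + y)"


section \<open>Complex algebras\<close>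

class complex_algebra_1 = ring_1 +
  fixes scaleC :: "complex \<Rightarrow> 'a \<Rightarrow> 'a"  (infixr \<open>*\<^sub>C\<close> 75)
  assumes scaleC_add_right: "c *\<^sub>C (a + b) = c *\<^sub>C a + c *\<^sub>C b"
    and scaleC_add_left: "(c + d) *\<^sub>C a = c *\<^sub>C a + d *\<^sub>C a"
    and scaleC_scaleC: "c *\<^sub>C d *\<^sub>C a = (c * d) *\<^sub>C a"
    and scaleC_one: "1 *\<^sub>C a = a"
    and mult_scaleC_left: "(c *\<^sub>C a) * b = c *\<^sub>C (a * b)"
    and mult_scaleC_right: "a * (c *\<^sub>C b) = c *\<^sub>C (a * b)"

global_interpretation complex_algebra:
  vector_space "scaleC :: complex \<Rightarrow> 'a \<Rightarrow> 'a::complex_algebra_1"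
  by standard (simp_all add: scaleC_add_right scaleC_add_left scaleC_scaleC scaleC_one)

definition algebra_hom :: "('a::complex_algebra_1 \<Rightarrow> 'b::complex_algebra_1) \<Rightarrow> bool" where
  "algebra_hom \<phi> \<longleftrightarrow> \<phi> 1 = 1 \<and> (\<forall>a b. \<phi> (a + b) = \<phi> a + \<phi> b) \<and>
     (\<forall>a b. \<phi> (a * b) = \<phi> a * \<phi> b) \<and> (\<forall>c a. \<phi> (c *\<^sub>C a) = c *\<^sub>C \<phi> a)"

definition conj_linear_antiautomorphism :: "('a::complex_algebra_1 \<Rightarrow> 'a) \<Rightarrow> bool" where
  "conj_linear_antiautomorphism \<sigma> \<longleftrightarrow> bij \<sigma> \<and> \<sigma> 1 = 1 \<and> (\<forall>a b. \<sigma> (a + b) = \<sigma> a + \<sigma> b) \<and>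
     (\<forall>a b. \<sigma> (a * b) = \<sigma> b * \<sigma> a) \<and> (\<forall>c a. \<sigma> (c *\<^sub>C a) = cnj c *\<^sub>C \<sigma> a)"

definition unit_inverse :: "'a::ring_1 \<Rightarrow> 'a" where
  "unit_inverse a = (THE b. a * b = 1 \<and> b * a = 1)"


section \<open>Affine Hecke algebras\<close>

locale hecke_parameters = based_root_datum D
  for D :: "('x::ab_group_add, 'y::ab_group_add) root_datum" +
  fixes q :: real and lam lams :: "'x \<Rightarrow> real"
  assumes q_gt_1: "1 < q"
    and lam_nonzero: "\<alpha> \<in> roots D \<Longrightarrow> lam \<alpha> \<noteq> 0"
    and lams_nonzero: "\<alpha> \<in> roots D \<Longrightarrow> lams \<alpha> \<noteq> 0"
    and lam_invariant: "\<lbrakk>w \<in> weyl D; \<alpha> \<in> roots D\<rbrakk> \<Longrightarrow> lam (w \<alpha>) = lam \<alpha>"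
    and lams_invariant: "\<lbrakk>w \<in> weyl D; \<alpha> \<in> roots D\<rbrakk> \<Longrightarrow> lams (w \<alpha>) = lams \<alpha>"
    and lam_eq_lams: "\<lbrakk>\<alpha> \<in> roots D; \<not> coroot_even D \<alpha>\<rbrakk> \<Longrightarrow> lam \<alpha> = lams \<alpha>"
    and lam_plus_lams: "\<lbrakk>\<alpha> \<in> roots D; coroot_even D \<alpha>\<rbrakk> \<Longrightarrow> lam \<alpha> + lams \<alpha> \<noteq> 0"

text \<open>The type \<open>'h\<close> is the affine Hecke algebra, with generators \<open>\<theta> x\<close> and \<open>T w\<close>
  (\<open>T\<close> is irrelevant outside \<open>weyl D\<close>). In the two cross relations, \<open>d\<close> is the quotient
  of \<open>\<theta> x - \<theta> (s x)\<close> by \<open>1 - \<theta> (- \<alpha>)\<close> respectively \<open>1 - \<theta> (- 2 \<alpha>)\<close>, taken in the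
  subalgebra spanned by the \<open>\<theta> x\<close>. The quotient exists there and is unique because that
  subalgebra is the group algebra of a lattice, hence an integral domain.\<close>

locale affine_hecke_algebra = hecke_parameters D q lam lams
  for D :: "('x::ab_group_add, 'y::ab_group_add) root_datum"
    and q :: real and lam lams :: "'x \<Rightarrow> real" +
  fixes \<theta> :: "'x \<Rightarrow> 'h::complex_algebra_1" and T :: "('x \<Rightarrow> 'x) \<Rightarrow> 'h"
  assumes basis_inj: "inj_on (\<lambda>(x, w). \<theta> x * T w) (UNIV \<times> weyl D)"
    and basis_independent:
      "complex_algebra.independent ((\<lambda>(x, w). \<theta> x * T w) ` (UNIV \<times> weyl D))"
    and basis_span: "complex_algebra.span ((\<lambda>(x, w). \<theta> x * T w) ` (UNIV \<times> weyl D)) = UNIV"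
    and T_mult: "\<lbrakk>w \<in> weyl D; w' \<in> weyl D; weyl_length D (w \<circ> w') = weyl_length D w + weyl_length D w'\<rbrakk>
      \<Longrightarrow> T w * T w' = T (w \<circ> w')"
    and T_quadratic: "\<alpha> \<in> simple_roots D \<Longrightarrow>
      (T (reflection D \<alpha>) + 1) *
      (T (reflection D \<alpha>) - complex_of_real (q powr lam \<alpha>) *\<^sub>C 1) = 0"
    and theta_mult: "\<theta> x * \<theta> y = \<theta> (x + y)"
    and cross_relation: "\<lbrakk>\<alpha> \<in> simple_roots D; \<not> coroot_even D \<alpha>; d \<in> complex_algebra.span (range \<theta>);
        d * (1 - \<theta> (- \<alpha>)) = \<theta> x - \<theta> (reflection D \<alpha> x)\<rbrakk> \<Longrightarrow>
      T (reflection D \<alpha>) * \<theta> x =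
        \<theta> (reflection D \<alpha> x) * T (reflection D \<alpha>) + complex_of_real (q powr lam \<alpha> - 1) *\<^sub>C d"
    and cross_relation_even: "\<lbrakk>\<alpha> \<in> simple_roots D; coroot_even D \<alpha>; d \<in> complex_algebra.span (range \<theta>);
        d * (1 - \<theta> (- (\<alpha> + \<alpha>))) = \<theta> x - \<theta> (reflection D \<alpha> x)\<rbrakk> \<Longrightarrow>
      T (reflection D \<alpha>) * \<theta> x =
        \<theta> (reflection D \<alpha> x) * T (reflection D \<alpha>) +
        (complex_of_real (q powr lam \<alpha> - 1) *\<^sub>C 1 +
         \<theta> (- \<alpha>) * (complex_of_real (q powr ((lam \<alpha> + lams \<alpha>) / 2)
                     - q powr ((lam \<alpha> - lams \<alpha>) / 2)) *\<^sub>C 1)) * d"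

text \<open>These conditions determine \<open>star\<close> uniquely, because the \<open>\<theta> x * T w\<close> span the algebra. The
  longest element \<open>w0\<close> exists and is unique.\<close>

locale hecke_star = affine_hecke_algebra D q lam lams \<theta> T
  for D :: "('x::ab_group_add, 'y::ab_group_add) root_datum"
    and q :: real and lam lams :: "'x \<Rightarrow> real"
    and \<theta> :: "'x \<Rightarrow> 'h::complex_algebra_1" and T :: "('x \<Rightarrow> 'x) \<Rightarrow> 'h" +
  fixes star :: "'h \<Rightarrow> 'h"
  assumes star_antiautomorphism: "conj_linear_antiautomorphism star"
    and star_T: "w \<in> weyl D \<Longrightarrow> star (T w) = T (inv_into UNIV w)"
    and star_theta: "is_longest D w0 \<Longrightarrow>
      star (\<theta> x) = T w0 * \<theta> (- w0 x) * unit_inverse (T w0)"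


section \<open>Isogenies\<close>

definition cokernel :: "('x1::ab_group_add \<Rightarrow> 'x2::ab_group_add) \<Rightarrow> 'x2 set set" where
  "cokernel f = UNIV // {(x, y). x - y \<in> range f}"

definition transpose_map :: "('x1, 'y1) root_datum \<Rightarrow> ('x2, 'y2) root_datum \<Rightarrow>
    ('x1 \<Rightarrow> 'x2) \<Rightarrow> 'y2 \<Rightarrow> 'y1" where
  "transpose_map D1 D2 f y2 = (THE y1. \<forall>x. pairing D1 x y1 = pairing D2 (f x) y2)"

locale root_datum_isogeny = D1: based_root_datum D1 + D2: based_root_datum D2
  for D1 :: "('x1::ab_group_add, 'y1::ab_group_add) root_datum"
    and D2 :: "('x2::ab_group_add, 'y2::ab_group_add) root_datum" +
  fixes f :: "'x1 \<Rightarrow> 'x2"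
  assumes additive_f: "additive f"
    and inj_f: "inj f"
    and finite_cokernel: "finite (cokernel f)"
    and f_roots: "f ` roots D1 = roots D2"
    and f_simple: "f ` simple_roots D1 = simple_roots D2"
    and transpose_coroot:
      "\<alpha> \<in> roots D1 \<Longrightarrow> transpose_map D1 D2 f (coroot D2 (f \<alpha>)) = coroot D1 \<alpha>"

text \<open>The identification of Weyl groups matches \<open>w1\<close> with the unique \<open>w2\<close> such that
  \<open>w2 \<circ> f = f \<circ> w1\<close>.\<close>

locale hecke_isogeny =
  H1: affine_hecke_algebra D1 q lam1 lams1 \<theta>1 T1 +
  H2: affine_hecke_algebra D2 q lam2 lams2 \<theta>2 T2 +
  root_datum_isogeny D1 D2 f
  for D1 :: "('x1::ab_group_add, 'y1::ab_group_add) root_datum"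
    and D2 :: "('x2::ab_group_add, 'y2::ab_group_add) root_datum"
    and q :: real and lam1 lams1 :: "'x1 \<Rightarrow> real" and lam2 lams2 :: "'x2 \<Rightarrow> real"
    and \<theta>1 :: "'x1 \<Rightarrow> 'h1::complex_algebra_1" and T1 :: "('x1 \<Rightarrow> 'x1) \<Rightarrow> 'h1"
    and \<theta>2 :: "'x2 \<Rightarrow> 'h2::complex_algebra_1" and T2 :: "('x2 \<Rightarrow> 'x2) \<Rightarrow> 'h2"
    and f :: "'x1 \<Rightarrow> 'x2" +
  fixes \<iota> :: "'h1 \<Rightarrow> 'h2"
  assumes lam_compatible: "\<alpha> \<in> roots D1 \<Longrightarrow> lam2 (f \<alpha>) = lam1 \<alpha>"
    and lams_compatible: "\<alpha> \<in> roots D1 \<Longrightarrow> lams2 (f \<alpha>) = lams1 \<alpha>"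
    and hom_iota: "algebra_hom \<iota>"
    and inj_iota: "inj \<iota>"
    and iota_basis: "\<lbrakk>w1 \<in> weyl D1; w2 \<in> weyl D2; w2 \<circ> f = f \<circ> w1\<rbrakk> \<Longrightarrow>
      \<iota> (\<theta>1 x * T1 w1) = \<theta>2 (f x) * T2 w2"

definition graded_component :: "('x::ab_group_add, 'y) root_datum \<Rightarrow> ('x \<Rightarrow> 'h::complex_algebra_1) \<Rightarrow>
    (('x \<Rightarrow> 'x) \<Rightarrow> 'h) \<Rightarrow> 'x set \<Rightarrow> 'h set" where
  "graded_component D \<theta> T g = complex_algebra.span {\<theta> x * T w | x w. x \<in> g \<and> w \<in> weyl D}"

text \<open>The projection \<open>E\<close> onto the degree zero component, read in the source of \<open>\<iota>\<close>. The
  zero element of the cokernel is the coset \<open>range f\<close>.\<close>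

definition degree_zero_projection :: "('x2::ab_group_add, 'y2) root_datum \<Rightarrow>
    ('x2 \<Rightarrow> 'h2::complex_algebra_1) \<Rightarrow> (('x2 \<Rightarrow> 'x2) \<Rightarrow> 'h2) \<Rightarrow>
    ('x1::ab_group_add \<Rightarrow> 'x2) \<Rightarrow> ('h1 \<Rightarrow> 'h2) \<Rightarrow> 'h2 \<Rightarrow> 'h1" where
  "degree_zero_projection D2 \<theta>2 T2 f \<iota> h = (THE h1. \<exists>d.
     (\<forall>g\<in>cokernel f. d g \<in> graded_component D2 \<theta>2 T2 g) \<and>
     h = (\<Sum>g\<in>cokernel f. d g) \<and> \<iota> h1 = d (range f))"


section \<open>Modules, hermitian duals and induction\<close>

text \<open>Left modules over a not necessarily commutative ring, on the record type of
  \<^theory>\<open>HOL-Algebra.Module\<close>, whose multiplicative fields are unused. When the ring is a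
  complex algebra, \<open>c\<close> acts on the module as \<open>c *\<^sub>C 1\<close>.\<close>

locale left_module = abelian_group M
  for M :: "('h::ring_1, 'v) module" (structure) +
  assumes smult_closed: "v \<in> carrier M \<Longrightarrow> h \<odot> v \<in> carrier M"
    and smult_add_left: "v \<in> carrier M \<Longrightarrow> (h + k) \<odot> v = h \<odot> v \<oplus> k \<odot> v"
    and smult_add_right: "\<lbrakk>u \<in> carrier M; v \<in> carrier M\<rbrakk> \<Longrightarrow> h \<odot> (u \<oplus> v) = h \<odot> u \<oplus> h \<odot> v"
    and smult_assoc: "v \<in> carrier M \<Longrightarrow> (h * k) \<odot> v = h \<odot> (k \<odot> v)"
    and smult_one: "v \<in> carrier M \<Longrightarrow> 1 \<odot> v = v"

locale left_module_iso = M: left_module M + N: left_module N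
  for M :: "('h::ring_1, 'v) module" and N :: "('h, 'w) module" +
  fixes \<phi> :: "'v \<Rightarrow> 'w"
  assumes bij: "bij_betw \<phi> (carrier M) (carrier N)"
    and hom_add: "\<lbrakk>u \<in> carrier M; v \<in> carrier M\<rbrakk> \<Longrightarrow> \<phi> (u \<oplus>\<^bsub>M\<^esub> v) = \<phi> u \<oplus>\<^bsub>N\<^esub> \<phi> v"
    and hom_smult: "v \<in> carrier M \<Longrightarrow> \<phi> (h \<odot>\<^bsub>M\<^esub> v) = h \<odot>\<^bsub>N\<^esub> \<phi> v"

text \<open>Functionals are functions on the carrier, extended by \<^term>\<open>undefined\<close>.\<close>

definition hermitian_dual :: "('h \<Rightarrow> 'h) \<Rightarrow> ('h::complex_algebra_1, 'v) module \<Rightarrow>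
    ('h, 'v \<Rightarrow> complex) module" where
  "hermitian_dual star M =
    \<lparr>carrier = {\<mu> \<in> extensional (carrier M).
        (\<forall>u\<in>carrier M. \<forall>v\<in>carrier M. \<mu> (u \<oplus>\<^bsub>M\<^esub> v) = \<mu> u + \<mu> v) \<and>
        (\<forall>c. \<forall>v\<in>carrier M. \<mu> ((c *\<^sub>C 1) \<odot>\<^bsub>M\<^esub> v) = cnj c * \<mu> v)},
     monoid.mult = undefined, one = undefined,
     ring.zero = (\<lambda>v\<in>carrier M. 0),
     ring.add = (\<lambda>\<mu> \<nu>. \<lambda>v\<in>carrier M. \<mu> v + \<nu> v),
     module.smult = (\<lambda>h \<mu>. \<lambda>v\<in>carrier M. \<mu> (star h \<odot>\<^bsub>M\<^esub> v))\<rparr>"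

text \<open>The induced module is the tensor product of \<open>'h2\<close>, a right module over \<open>'h1\<close> via \<open>\<iota>\<close>,
  with \<open>M\<close>: the free abelian group on pairs modulo the subgroup generated by the usual
  relations.\<close>

definition tensor_free :: "('h1, 'v) module \<Rightarrow> (('h2 \<times> 'v) \<Rightarrow>\<^sub>0 int) monoid" where
  "tensor_free M = free_Abelian_group (UNIV \<times> carrier M)"

definition tensor_relations :: "('h1 \<Rightarrow> 'h2::ring_1) \<Rightarrow> ('h1, 'v) module \<Rightarrow>
    (('h2 \<times> 'v) \<Rightarrow>\<^sub>0 int) set" where
  "tensor_relations \<iota> M = generate (tensor_free M)
     ({frag_of (a + b, v) - frag_of (a, v) - frag_of (b, v) | a b v. v \<in> carrier M} \<union>
      {frag_of (a, u \<oplus>\<^bsub>M\<^esub> v) - frag_of (a, u) - frag_of (a, v) | a u v.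
         u \<in> carrier M \<and> v \<in> carrier M} \<union>
      {frag_of (a * \<iota> h, v) - frag_of (a, h \<odot>\<^bsub>M\<^esub> v) | a h v. v \<in> carrier M})"

definition tensor :: "('h1 \<Rightarrow> 'h2::ring_1) \<Rightarrow> ('h1, 'v) module \<Rightarrow> 'h2 \<Rightarrow> 'v \<Rightarrow>
    (('h2 \<times> 'v) \<Rightarrow>\<^sub>0 int) set" where
  "tensor \<iota> M a v = tensor_relations \<iota> M #>\<^bsub>tensor_free M\<^esub> frag_of (a, v)"

definition induced_module :: "('h1 \<Rightarrow> 'h2::ring_1) \<Rightarrow> ('h1, 'v) module \<Rightarrow>
    ('h2, (('h2 \<times> 'v) \<Rightarrow>\<^sub>0 int) set) module" where
  "induced_module \<iota> M =
    \<lparr>carrier = carrier (tensor_free M Mod tensor_relations \<iota> M),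
     monoid.mult = undefined, one = undefined,
     ring.zero = \<one>\<^bsub>tensor_free M Mod tensor_relations \<iota> M\<^esub>,
     ring.add = (\<otimes>\<^bsub>tensor_free M Mod tensor_relations \<iota> M\<^esub>),
     module.smult = (\<lambda>h Z. \<Union>z\<in>Z. tensor_relations \<iota> M #>\<^bsub>tensor_free M\<^esub>
                       frag_extend (\<lambda>(a, v). frag_of (h * a, v)) z)\<rparr>"

text \<open>Pairings linear in the first and conjugate-linear in the second argument.\<close>

definition sesquilinear_pairings :: "('h::complex_algebra_1, 'v) module \<Rightarrow> ('h, 'w) module \<Rightarrow>
    ('v \<Rightarrow> 'w \<Rightarrow> complex) set" where
  "sesquilinear_pairings M N =
    {B \<in> carrier M \<rightarrow>\<^sub>E carrier N \<rightarrow>\<^sub>E UNIV.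
       (\<forall>u\<in>carrier M. \<forall>u'\<in>carrier M. \<forall>v\<in>carrier N. B (u \<oplus>\<^bsub>M\<^esub> u') v = B u v + B u' v) \<and>
       (\<forall>u\<in>carrier M. \<forall>v\<in>carrier N. \<forall>v'\<in>carrier N. B u (v \<oplus>\<^bsub>N\<^esub> v') = B u v + B u v') \<and>
       (\<forall>c. \<forall>u\<in>carrier M. \<forall>v\<in>carrier N. B ((c *\<^sub>C 1) \<odot>\<^bsub>M\<^esub> u) v = c * B u v) \<and>
       (\<forall>c. \<forall>u\<in>carrier M. \<forall>v\<in>carrier N. B u ((c *\<^sub>C 1) \<odot>\<^bsub>N\<^esub> v) = cnj c * B u v)}"

definition is_induced_pairing :: "('h1 \<Rightarrow> 'h2) \<Rightarrow> ('h1::complex_algebra_1 \<Rightarrow> 'h1) \<Rightarrow>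
    ('h2::complex_algebra_1 \<Rightarrow> 'h2) \<Rightarrow> ('h2 \<Rightarrow> 'h1) \<Rightarrow> ('h1, 'v) module \<Rightarrow>
    ((('h2 \<times> ('v \<Rightarrow> complex)) \<Rightarrow>\<^sub>0 int) set \<Rightarrow> (('h2 \<times> 'v) \<Rightarrow>\<^sub>0 int) set \<Rightarrow> complex) \<Rightarrow> bool" where
  "is_induced_pairing \<iota> star1 star2 E V B \<longleftrightarrow>
     B \<in> sesquilinear_pairings (induced_module \<iota> (hermitian_dual star1 V)) (induced_module \<iota> V) \<and>
     (\<forall>h' h. \<forall>\<mu>\<in>carrier (hermitian_dual star1 V). \<forall>v\<in>carrier V.
        B (tensor \<iota> (hermitian_dual star1 V) h' \<mu>) (tensor \<iota> V h v) =
          (E (star2 h * h') \<odot>\<^bsub>hermitian_dual star1 V\<^esub> \<mu>) v)"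

end

theory Submission
  imports Defs
begin

text \<open>The algebra \<open>H2\<close> is a free module over \<open>H1\<close> on both sides, with basis \<open>\<theta> x\<close> for \<open>x\<close> in a set
  of representatives of the cokernel, because \<open>T w * \<theta> x\<close> lies in \<open>\<theta> x * H1\<close>; the projection \<open>E\<close> is
  a bimodule map for which \<open>\<theta> x\<close> and \<open>\<theta> (- x)\<close> are dual bases. So \<open>H1 \<subseteq> H2\<close> is a Frobenius
  extension, compatible with the star operations. A functional \<open>\<Lambda>\<close> on the induced module is then the
  pairing with \<open>\<Sum>x. \<theta> x \<otimes> \<mu>\<^sub>x\<close>, where \<open>\<mu>\<^sub>x v = \<Lambda> (star (\<theta> (- x)) \<otimes> v)\<close>.\<close>

section \<open>Root data and Weyl groups\<close>

text \<open>Homogeneity comes from the roots: they lie in \<open>range f\<close>, and the cross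
  relations shift exponents only by multiples of a root, so moving \<open>T w\<close> past
  \<open>\<theta> x\<close> never changes the class of \<open>x\<close> modulo
  \<open>range f\<close>. The star operations are the harder ingredient. They are prescribed on
  \<open>\<theta> x\<close> through a longest Weyl group element, so their involutivity and their
  compatibility with \<open>\<iota>\<close> rest on the existence of such an element and on
  \<open>f\<close> preserving lengths. The root datum supplies only reflections, a base and a
  perfect pairing; finiteness of the Weyl group and its generation by simple reflections are
  therefore derived, with the help of invariant sums over roots and coroots. The two expansions of
  an element of \<open>H2\<close> play different roles: the one with coefficients on the right
  recovers a tensor from its functional, and the one with coefficients on the left, after applying
  the star operation, shows that every functional is reached.\<close>

lemma additive_zscale: "additive \<phi> \<Longrightarrow> \<phi> (zscale k x) = zscale k (\<phi> x)"
  by (simp add: zscale_def additive.sum additive.minus)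

lemma zscale_int: "zscale k (m::int) = k * m"
  by (simp add: zscale_def)

context based_root_datum
begin

lemma additive_pairing: "additive (pairing D x)" "additive (\<lambda>x. pairing D x y)"
  using perfect by (auto simp: perfect_pairing_def)

lemmas pairing_simps =
  additive.add[OF additive_pairing(1)] additive.add[OF additive_pairing(2)]
  additive.diff[OF additive_pairing(1)] additive.diff[OF additive_pairing(2)]
  additive.minus[OF additive_pairing(1)] additive.minus[OF additive_pairing(2)]
  additive.zero[OF additive_pairing(1)] additive.zero[OF additive_pairing(2)]
  additive.sum[OF additive_pairing(1)] additive.sum[OF additive_pairing(2)]
  additive_zscale[OF additive_pairing(1)] additive_zscale[OF additive_pairing(2)] zscale_int

text \<open>Both \<open>x\<close> and 0 represent the zero functional, and perfectness makes the
  representing element unique.\<close>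

lemma nondegenerate:
  assumes "\<And>y. pairing D x y = 0" shows "x = 0"
proof -
  have "\<exists>!x. (\<lambda>y. 0) = pairing D x"
    using perfect by (auto simp: perfect_pairing_def additive_def)
  moreover have "(\<lambda>y. 0) = pairing D x" "(\<lambda>y. 0) = pairing D 0"
    using assms by (auto simp: pairing_simps)
  ultimately show ?thesis by blast
qed

text \<open>Pairings with \<open>y\<close> take integer values, so the nonzero factor
  \<open>m\<close> can be cancelled there, and nondegeneracy lifts the conclusion to the
  lattice.\<close>

lemma torsion_free:
  assumes "zscale m x = 0" "m \<noteq> 0" shows "x = (0::'x)"
proof (rule nondegenerate)
  fix y
  have "m * pairing D x y = pairing D (zscale m x) y" by (simp add: pairing_simps)
  then show "pairing D x y = 0" using assms by (simp add: pairing_simps)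
qed

lemma root_nonzero: "\<alpha> \<in> roots D \<Longrightarrow> \<alpha> \<noteq> 0"
  using pairing_coroot[of \<alpha>] by (auto simp: pairing_simps)

lemma reflection_add: "reflection D \<alpha> (x + y) = reflection D \<alpha> x + reflection D \<alpha> y"
  by (simp add: reflection_def pairing_simps zscale_add_left)

lemma reflection_self: "\<alpha> \<in> roots D \<Longrightarrow> reflection D \<alpha> \<alpha> = - \<alpha>"
  using zscale_add_left[of 1 1 \<alpha>] by (simp add: reflection_def pairing_coroot zscale_one)

lemma reflection_involution:
  assumes "\<alpha> \<in> roots D" shows "reflection D \<alpha> (reflection D \<alpha> x) = x"
  using assms int_module.scale_minus_left[of "pairing D x (coroot D \<alpha>)" \<alpha>]
  by (simp add: reflection_def pairing_simps pairing_coroot)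

lemma reflection_involution_o:
  "\<alpha> \<in> roots D \<Longrightarrow> reflection D \<alpha> \<circ> reflection D \<alpha> = id"
  by (auto simp: reflection_involution)

lemma pairing_reflection:
  "pairing D (reflection D \<alpha> x) y = pairing D x (coreflection D \<alpha> y)"
  by (simp add: reflection_def coreflection_def pairing_simps mult.commute)

lemma reflection_weyl: "\<alpha> \<in> roots D \<Longrightarrow> reflection D \<alpha> \<in> weyl D"
  using weyl_reflection[OF _ weyl_id] by auto

lemma weyl_add: "w \<in> weyl D \<Longrightarrow> w (x + y) = w x + w y"
  by (induction arbitrary: x y rule: weyl.induct) (auto simp: reflection_add)

lemma weyl_additive: "w \<in> weyl D \<Longrightarrow> additive w"
  by (simp add: additive_def weyl_add)

lemma weyl_roots: "w \<in> weyl D \<Longrightarrow> w ` roots D = roots D"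
proof (induction rule: weyl.induct)
  case (weyl_reflection \<alpha> w)
  then show ?case using image_comp reflection_roots by metis
qed simp

lemma weyl_comp: "v \<in> weyl D \<Longrightarrow> w \<in> weyl D \<Longrightarrow> v \<circ> w \<in> weyl D"
  by (induction rule: weyl.induct) (auto simp: comp_assoc intro: weyl_reflection)

lemma weyl_inverse:
  assumes "w \<in> weyl D"
  shows "\<exists>v\<in>weyl D. v \<circ> w = id \<and> w \<circ> v = id"
  using assms
proof (induction rule: weyl.induct)
  case weyl_id
  show ?case by (intro bexI[of _ id] weyl.weyl_id) simp
next
  case (weyl_reflection \<alpha> w)
  then obtain v where v: "v \<in> weyl D" "v \<circ> w = id" "w \<circ> v = id" by blast
  then have "v \<circ> reflection D \<alpha> \<in> weyl D"
    using weyl_comp reflection_weyl weyl_reflection by blast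
  moreover have "(v \<circ> reflection D \<alpha>) \<circ> (reflection D \<alpha> \<circ> w) = id"
    using v(2) weyl_reflection(1) by (auto simp: fun_eq_iff reflection_involution)
  moreover have "(reflection D \<alpha> \<circ> w) \<circ> (v \<circ> reflection D \<alpha>) = id"
    using v(3) weyl_reflection(1) by (auto simp: fun_eq_iff reflection_involution)
  ultimately show ?case by blast
qed

lemma weyl_bij: "w \<in> weyl D \<Longrightarrow> bij w"
  using weyl_inverse o_bij by blast

lemma weyl_inv_into: "w \<in> weyl D \<Longrightarrow> inv_into UNIV w \<in> weyl D"
  using weyl_inverse[of w] inv_unique_comp[of w] by metis

section \<open>Transposes of Weyl group elements and the invariant form\<close>

lemma weyl_transpose:
  assumes "w \<in> weyl D"
  shows "\<exists>w'. (\<forall>x y. pairing D (w x) y = pairing D x (w' y)) \<and>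
    w' ` coroot D ` roots D = coroot D ` roots D"
  using assms
proof (induction rule: weyl.induct)
  case weyl_id
  then show ?case by (intro exI[of _ id]) simp
next
  case (weyl_reflection \<alpha> w)
  then obtain w' where w': "\<forall>x y. pairing D (w x) y = pairing D x (w' y)"
      "w' ` coroot D ` roots D = coroot D ` roots D" by blast
  have "(w' \<circ> coreflection D \<alpha>) ` coroot D ` roots D =
      w' ` coreflection D \<alpha> ` coroot D ` roots D"
    by (simp add: image_comp comp_assoc)
  then have "(w' \<circ> coreflection D \<alpha>) ` coroot D ` roots D = coroot D ` roots D"
    by (simp add: coreflection_coroots[OF weyl_reflection(1)] w'(2))
  then show ?case using w'(1)
    by (intro exI[of _ "w' \<circ> coreflection D \<alpha>"]) (simp add: pairing_reflection)
qed

text \<open>The canonical Weyl group invariant form: transposes of Weyl group elements permute the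
  coroots. On X it is only semidefinite, its radical being the vectors orthogonal to all coroots,
  but it is positive on a root, which pairs to 2 with its own coroot.\<close>

definition form :: "'x \<Rightarrow> 'x \<Rightarrow> int" where
  "form x y = (\<Sum>c\<in>coroot D ` roots D. pairing D x c * pairing D y c)"

lemma form_simps:
  "form (x + x') y = form x y + form x' y" "form x (y + y') = form x y + form x y'"
  "form (- x) y = - form x y" "form x (- y) = - form x y"
  "form (x - x') y = form x y - form x' y"
  "form (zscale k x) y = k * form x y"
  by (simp_all add: form_def pairing_simps algebra_simps sum.distrib sum_negf sum_distrib_left
      sum_subtractf)

lemma form_commute: "form x y = form y x"
  by (simp add: form_def mult.commute)

lemma form_nonneg: "0 \<le> form x x"
  by (simp add: form_def sum_nonneg)

lemma form_root_pos:
  assumes "\<alpha> \<in> roots D" shows "0 < form \<alpha> \<alpha>"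
  unfolding form_def
  by (rule sum_pos2[of _ "coroot D \<alpha>"]) (use assms finite_roots pairing_coroot in auto)

lemma form_weyl:
  assumes "w \<in> weyl D" shows "form (w x) (w y) = form x y"
proof -
  obtain w' where w': "\<forall>x y. pairing D (w x) y = pairing D x (w' y)"
    "w' ` coroot D ` roots D = coroot D ` roots D" using weyl_transpose[OF assms] by blast
  have fin: "finite (coroot D ` roots D)" using finite_roots by simp
  \<comment> \<open>A surjection of a finite set onto itself is injective, as reindexing the sum
    requires.\<close>
  have inj: "inj_on w' (coroot D ` roots D)"
    using w'(2) fin by (simp add: eq_card_imp_inj_on)
  have "form x y = (\<Sum>c\<in>w' ` coroot D ` roots D. pairing D x c * pairing D y c)"
    by (simp only: w'(2) form_def)
  also have "\<dots> = form (w x) (w y)"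
    unfolding form_def by (subst sum.reindex[OF inj]) (simp add: w'(1))
  finally show ?thesis by simp
qed

text \<open>The classical description of the coroot as 2(., \<alpha>)/(\<alpha>, \<alpha>), cleared
  of denominators. Reflecting both arguments in \<alpha> turns the second into
  \<open>- \<alpha>\<close>, so \<open>form x \<alpha>\<close> becomes its own negative plus the
  pairing term.\<close>

lemma form_root:
  assumes "\<alpha> \<in> roots D"
  shows "2 * form x \<alpha> = form \<alpha> \<alpha> * pairing D x (coroot D \<alpha>)"
proof -
  have "form x \<alpha> = form (reflection D \<alpha> x) (- \<alpha>)"
    using form_weyl[OF reflection_weyl[OF assms], of x \<alpha>] reflection_self[OF assms] by simp
  then show ?thesis by (simp add: reflection_def form_simps)
qed

text \<open>The invariant form determines the coroot of a root, so conjugation by a Weyl group element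
  carries reflections to reflections.\<close>

lemma reflection_conjugate:
  assumes w: "w \<in> weyl D" and v: "v \<in> weyl D" "w \<circ> v = id" and \<alpha>: "\<alpha> \<in> roots D"
  shows "w \<circ> reflection D \<alpha> \<circ> v = reflection D (w \<alpha>)"
proof
  fix x
  have wv: "w (v x) = x" using v(2) by (metis comp_apply id_apply)
  have w\<alpha>: "w \<alpha> \<in> roots D" using weyl_roots[OF w] \<alpha> by blast
  have "form \<alpha> \<alpha> * pairing D (v x) (coroot D \<alpha>) = 2 * form (v x) \<alpha>"
    using form_root[OF \<alpha>] by simp
  also have "\<dots> = 2 * form x (w \<alpha>)" using form_weyl[OF w, of "v x" \<alpha>] wv by simp
  also have "\<dots> = form \<alpha> \<alpha> * pairing D x (coroot D (w \<alpha>))"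
    using form_root[OF w\<alpha>] form_weyl[OF w] by simp
  finally have "pairing D (v x) (coroot D \<alpha>) = pairing D x (coroot D (w \<alpha>))"
    using form_root_pos[OF \<alpha>] by simp
  then show "(w \<circ> reflection D \<alpha> \<circ> v) x = reflection D (w \<alpha>) x"
    using wv by (simp add: reflection_def additive.diff[OF weyl_additive[OF w]]
        additive_zscale[OF weyl_additive[OF w]])
qed

text \<open>Two Weyl group elements thus differ at every point by a vector of the root span, where
  orthogonality to all coroots forces zero. In all of X it does not, since X may be larger than the
  root span allows.\<close>

lemma weyl_diff_in_span:
  assumes "w \<in> weyl D" shows "w x - x \<in> int_module.span (roots D)"
  using assms
proof (induction rule: weyl.induct)
  case weyl_id
  then show ?case by (simp add: int_module.span_zero)
next
  case (weyl_reflection \<alpha> w)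
  have "(reflection D \<alpha> \<circ> w) x - x = (w x - x) - zscale (pairing D (w x) (coroot D \<alpha>)) \<alpha>"
    by (simp add: reflection_def)
  then show ?case
    using weyl_reflection int_module.span_diff int_module.span_scale int_module.span_base by metis
qed

text \<open>With \<open>t y = (\<Sum>\<alpha>. \<langle>\<alpha>, y\<rangle> \<alpha>)\<close>, invariance under reflections makes \<open>t \<beta>\<^sup>\<or>\<close> a positive
  multiple of \<open>\<beta>\<close>. Hence \<open>m z = t y\<close> with \<open>m > 0\<close>, and \<open>\<langle>t y, y\<rangle>\<close> is a sum of squares.\<close>

lemma root_span_orthogonal:
  assumes z: "z \<in> int_module.span (roots D)"
    and orth: "\<And>\<alpha>. \<alpha> \<in> roots D \<Longrightarrow> pairing D z (coroot D \<alpha>) = 0"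
  shows "z = 0"
proof -
  define t where "t y = (\<Sum>\<alpha>\<in>roots D. zscale (pairing D \<alpha> y) \<alpha>)" for y
  let ?S = "int_module.span (coroot D ` roots D)"
  have t_add: "t (y + y') = t y + t y'" for y y'
    by (simp add: t_def pairing_simps zscale_add_left sum.distrib)
  have t_scale: "t (zscale k y) = zscale k (t y)" for k y
    using additive_zscale[of t] t_add by (simp add: additive_def)
  have pairing_t: "pairing D (t y) y' = (\<Sum>\<alpha>\<in>roots D. pairing D \<alpha> y * pairing D \<alpha> y')" for y y'
    by (simp add: t_def pairing_simps)
  have t_coroot: "zscale 2 (t (coroot D \<beta>)) = zscale (pairing D (t (coroot D \<beta>)) (coroot D \<beta>)) \<beta>"
    if \<beta>: "\<beta> \<in> roots D" for \<beta>
  proof -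
    let ?s = "reflection D \<beta>" and ?c = "coroot D \<beta>"
    have inj: "inj_on ?s (roots D)"
      using reflection_involution[OF \<beta>] by (metis inj_onI)
    have ad: "additive ?s" by (simp add: additive_def reflection_add)
    have co: "coreflection D \<beta> ?c = - ?c"
      using zscale_add_left[of 1 1 ?c] \<beta> by (simp add: coreflection_def pairing_coroot zscale_one)
    have "t ?c = (\<Sum>\<alpha>\<in>?s ` roots D. zscale (pairing D \<alpha> ?c) \<alpha>)"
      by (simp only: t_def reflection_roots[OF \<beta>])
    also have "\<dots> = (\<Sum>\<alpha>\<in>roots D. zscale (pairing D (?s \<alpha>) ?c) (?s \<alpha>))"
      by (subst sum.reindex[OF inj]) simp
    also have "\<dots> = - ?s (t ?c)"
      by (simp add: t_def pairing_reflection co pairing_simps zscale_minus sum_negf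
          additive.sum[OF ad] additive_zscale[OF ad])
    finally have "t ?c + t ?c = zscale (pairing D (t ?c) ?c) \<beta>"
      by (simp add: reflection_def algebra_simps)
    then show ?thesis using zscale_add_left[of 1 1 "t ?c"] by (simp add: zscale_one)
  qed
  have "\<exists>m>0. \<exists>y\<in>?S. zscale m z = t y"
    using z
  proof (induction rule: int_module.span_induct_alt)
    case base
    show ?case
      by (rule exI[of _ 1]) (auto intro!: bexI[of _ 0] simp: t_def pairing_simps
          int_module.span_zero)
  next
    case (step k \<beta> z)
    then obtain m y where m: "m > 0" "y \<in> ?S" "zscale m z = t y" by blast
    let ?c = "coroot D \<beta>"
    define n where "n = pairing D (t ?c) ?c"
    have n: "n > 0"
      unfolding n_def pairing_t
      by (rule sum_pos2[of _ \<beta>]) (use finite_roots step(1) pairing_coroot in auto)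
    have "zscale (m * n) (zscale k \<beta> + z) =
        zscale (m * k) (zscale n \<beta>) + zscale n (zscale m z)"
      by (simp add: zscale_add_right zscale_zscale mult_ac)
    also have "\<dots> = t (zscale (2 * m * k) ?c + zscale n y)"
    proof -
      have "zscale (2 * m * k) (t ?c) = zscale (m * k) (zscale 2 (t ?c))"
        by (simp add: zscale_zscale mult_ac)
      also have "\<dots> = zscale (m * k) (zscale n \<beta>)" using t_coroot[OF step(1)] n_def by simp
      finally show ?thesis by (simp add: t_add t_scale m(3))
    qed
    finally have "zscale (m * n) (zscale k \<beta> + z) = t (zscale (2 * m * k) ?c + zscale n y)" .
    moreover have "zscale (2 * m * k) ?c + zscale n y \<in> ?S"
      by (intro int_module.span_add int_module.span_scale m(2) int_module.span_base)
        (use step(1) in auto)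
    ultimately show ?case using m(1) n by (meson mult_pos_pos)
  qed
  then obtain m y where m: "m > 0" "y \<in> ?S" "zscale m z = t y" by blast
  have "pairing D z y = 0"
    using m(2)
  proof (induction rule: int_module.span_induct_alt)
    case base
    show ?case by (simp add: pairing_simps)
  next
    case (step c x y)
    then show ?case using orth by (auto simp: pairing_simps)
  qed
  then have "(\<Sum>\<alpha>\<in>roots D. pairing D \<alpha> y * pairing D \<alpha> y) = 0"
    using pairing_t[of y y] by (simp add: m(3)[symmetric] pairing_simps)
  then have "\<forall>\<alpha>\<in>roots D. pairing D \<alpha> y = 0"
    using sum_nonneg_eq_0_iff[OF finite_roots, of "\<lambda>\<alpha>. pairing D \<alpha> y * pairing D \<alpha> y"] by simp
  then have "t y = 0" by (simp add: t_def)
  then show ?thesis using torsion_free[of m z] m by simp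
qed

text \<open>An element is determined by the map that its transpose induces on the finite set of
  coroots: if two elements induce the same map, their difference at \<open>x\<close> lies in the
  root span and pairs to zero with every coroot.\<close>

lemma finite_weyl: "finite (weyl D)"
proof -
  let ?C = "coroot D ` roots D"
  obtain t where t: "\<And>w. w \<in> weyl D \<Longrightarrow> (\<forall>x y. pairing D (w x) y = pairing D x (t w y)) \<and> t w ` ?C =
      ?C"
    using weyl_transpose by metis
  have "inj_on (\<lambda>w. restrict (t w) ?C) (weyl D)"
  proof
    fix v w assume vw: "v \<in> weyl D" "w \<in> weyl D" and eq: "restrict (t v) ?C = restrict (t w) ?C"
    show "v = w"
    proof
      fix x
      have "v x - w x = (v x - x) - (w x - x)" by simp
      then have "v x - w x \<in> int_module.span (roots D)"
        using weyl_diff_in_span vw int_module.span_diff by metis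
      moreover have "pairing D (v x - w x) (coroot D \<alpha>) = 0" if "\<alpha> \<in> roots D" for \<alpha>
      proof -
        have "t v (coroot D \<alpha>) = t w (coroot D \<alpha>)"
          using fun_cong[OF eq, of "coroot D \<alpha>"] that by simp
        then show ?thesis using t vw by (simp add: pairing_simps)
      qed
      ultimately show "v x = w x" using root_span_orthogonal[of "v x - w x"] by simp
    qed
  qed
  moreover have "(\<lambda>w. restrict (t w) ?C) ` weyl D \<subseteq> ?C \<rightarrow>\<^sub>E ?C"
  proof
    fix g assume "g \<in> (\<lambda>w. restrict (t w) ?C) ` weyl D"
    then obtain w where w: "w \<in> weyl D" "g = restrict (t w) ?C" by blast
    have "t w c \<in> ?C" if "c \<in> ?C" for c using t[OF w(1)] that by blast
    then show "g \<in> ?C \<rightarrow>\<^sub>E ?C" using w(2) by simp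
  qed
  moreover have "finite (?C \<rightarrow>\<^sub>E ?C)" using finite_roots by (intro finite_PiE) auto
  ultimately show ?thesis using finite_subset finite_imageD by metis
qed

text \<open>The formula \<open>star_theta\<close> speaks about longest elements, so an actual one is
  required before \<open>star (\<theta> x)\<close> can be computed.\<close>

lemma longest_exists: "\<exists>w. is_longest D w"
proof -
  let ?L = "weyl_length D ` weyl D"
  have fin: "finite ?L" using finite_weyl by simp
  then have "Max ?L \<in> ?L" using weyl.weyl_id[of D] by (intro Max_in) blast+
  then obtain w where w: "w \<in> weyl D" "Max ?L = weyl_length D w" by blast
  have "weyl_length D v \<le> Max ?L" if "v \<in> weyl D" for v
    using fin that by (intro Max_ge imageI)
  then show ?thesis using w unfolding is_longest_def by metis
qed

section \<open>Generation by simple reflections, and reduced words\<close>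

definition word :: "'x list \<Rightarrow> 'x \<Rightarrow> 'x" where
  "word as = foldr (\<circ>) (map (reflection D) as) id"

lemma word_Nil: "word [] = id"
  unfolding word_def list.map foldr.simps id_apply ..

lemma word_Cons: "word (a # as) = reflection D a \<circ> word as"
  unfolding word_def list.map foldr.simps comp_apply ..

lemma word_append: "word (as @ bs) = word as \<circ> word bs"
  by (induction as) (simp_all only: append.simps word_Nil word_Cons id_comp comp_assoc)

lemma word_singleton: "word [a] = reflection D a"
  by (simp only: word_Nil word_Cons comp_id)

definition simple_weyl :: "('x \<Rightarrow> 'x) set" where
  "simple_weyl = {word as | as. set as \<subseteq> simple_roots D}"

lemma simple_weyl_comp: "v \<in> simple_weyl \<Longrightarrow> w \<in> simple_weyl \<Longrightarrow> v \<circ> w \<in> simple_weyl"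
  unfolding simple_weyl_def using word_append
  by (smt (verit) Un_least mem_Collect_eq set_append)

lemma simple_reflection: "\<delta> \<in> simple_roots D \<Longrightarrow> reflection D \<delta> \<in> simple_weyl"
  unfolding simple_weyl_def by (rule CollectI, rule exI[of _ "[\<delta>]"]) (simp add: word_singleton)

lemma finite_simple: "finite (simple_roots D)"
  using simple_subset finite_roots finite_subset by blast

lemma simple_coefficients_unique:
  assumes "(\<Sum>\<delta>\<in>simple_roots D. zscale (c \<delta>) \<delta>) = (\<Sum>\<delta>\<in>simple_roots D. zscale (c' \<delta>) \<delta>)"
    and "\<delta> \<in> simple_roots D"
  shows "c \<delta> = c' \<delta>"
proof -
  have "(\<Sum>\<delta>\<in>simple_roots D. zscale (c \<delta> - c' \<delta>) \<delta>) = 0"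
    using assms(1) by (simp add: int_module.scale_left_diff_distrib sum_subtractf)
  then show ?thesis
    using simple_independent finite_simple assms(2)
    unfolding int_module.dependent_explicit by fastforce
qed

text \<open>Induction on the height. Some simple \<delta> in the support of \<alpha> has positive
  pairing with it. If the image of \<alpha> under the reflection in \<delta> is again positive, it
  has smaller height, and the two reflections are conjugate; otherwise \<alpha> is a multiple of
  \<delta>, hence equal to \<delta> because the datum is reduced.\<close>

lemma positive_root_reflection:
  assumes "\<alpha> \<in> roots D" "\<alpha> = (\<Sum>\<delta>\<in>simple_roots D. zscale (c \<delta>) \<delta>)"
    and "\<forall>\<delta>\<in>simple_roots D. 0 \<le> c \<delta>"
  shows "reflection D \<alpha> \<in> simple_weyl"
  using assms
proof (induction "nat (\<Sum>\<delta>\<in>simple_roots D. c \<delta>)" arbitrary: \<alpha> c rule: less_induct)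
  case less
  note root = less.prems(1) and sum = less.prems(2) and nonneg = less.prems(3)
  \<comment> \<open>Otherwise every term of \<open>2 * form \<alpha> \<alpha>\<close>, expanded
    along the simple roots in the first argument, would be nonpositive by \<open>form_root\<close>,
    against \<open>form_root_pos\<close>.\<close>
  have "\<exists>\<delta>\<in>simple_roots D. 0 < c \<delta> \<and> 0 < pairing D \<alpha> (coroot D \<delta>)"
  proof (rule ccontr)
    assume "\<not> ?thesis"
    then have neg: "c \<delta> = 0 \<or> pairing D \<alpha> (coroot D \<delta>) \<le> 0" if "\<delta> \<in> simple_roots D" for \<delta>
      using that nonneg by force
    have ad: "additive (\<lambda>x. 2 * form x \<alpha>)" by (simp add: additive_def form_simps)
    have "2 * form \<alpha> \<alpha> = (\<Sum>\<delta>\<in>simple_roots D. 2 * form (zscale (c \<delta>) \<delta>) \<alpha>)"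
      by (subst (1) sum) (rule additive.sum[OF ad])
    also have "\<dots> = (\<Sum>\<delta>\<in>simple_roots D. c \<delta> * (form \<delta> \<delta> * pairing D \<alpha> (coroot D \<delta>)))"
    proof (rule sum.cong)
      fix \<delta> assume "\<delta> \<in> simple_roots D"
      then have "\<delta> \<in> roots D" using simple_subset by blast
      from form_root[OF this, of \<alpha>]
      show "2 * form (zscale (c \<delta>) \<delta>) \<alpha> = c \<delta> * (form \<delta> \<delta> * pairing D \<alpha> (coroot D \<delta>))"
        by (simp add: form_simps form_commute[of \<delta> \<alpha>])
    qed simp
    also have "\<dots> \<le> 0"
    proof (rule sum_nonpos)
      fix \<delta> assume "\<delta> \<in> simple_roots D"
      then show "c \<delta> * (form \<delta> \<delta> * pairing D \<alpha> (coroot D \<delta>)) \<le> 0"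
        using neg[of \<delta>] nonneg form_nonneg[of \<delta>]
        by (metis mult_nonneg_nonpos mult_zero_left order_refl)
    qed
    finally show False using form_root_pos[OF root] by simp
  qed
  then obtain \<delta> where \<delta>: "\<delta> \<in> simple_roots D" "0 < c \<delta>" "0 < pairing D \<alpha> (coroot D \<delta>)" by blast
  define k where "k = pairing D \<alpha> (coroot D \<delta>)"
  have \<delta>root: "\<delta> \<in> roots D" using \<delta>(1) simple_subset by blast
  define \<beta> where "\<beta> = reflection D \<delta> \<alpha>"
  have \<beta>: "\<beta> \<in> roots D" using reflection_roots[OF \<delta>root] root \<beta>_def by blast
  define b where "b = c(\<delta> := c \<delta> - k)"
  have "(\<Sum>\<epsilon>\<in>simple_roots D. zscale (b \<epsilon>) \<epsilon>) =
      zscale (c \<delta> - k) \<delta> + (\<Sum>\<epsilon>\<in>simple_roots D - {\<delta>}. zscale (c \<epsilon>) \<epsilon>)"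
    using sum.remove[OF finite_simple \<delta>(1), of "\<lambda>\<epsilon>. zscale (b \<epsilon>) \<epsilon>"] by (simp add: b_def)
  also have "\<dots> = \<alpha> - zscale k \<delta>"
    using sum sum.remove[OF finite_simple \<delta>(1), of "\<lambda>\<epsilon>. zscale (c \<epsilon>) \<epsilon>"]
    by (simp add: int_module.scale_left_diff_distrib)
  finally have \<beta>sum: "\<beta> = (\<Sum>\<epsilon>\<in>simple_roots D. zscale (b \<epsilon>) \<epsilon>)"
    by (simp add: \<beta>_def reflection_def k_def)
  obtain b' where b': "\<beta> = (\<Sum>\<epsilon>\<in>simple_roots D. zscale (b' \<epsilon>) \<epsilon>)"
      "(\<forall>\<epsilon>\<in>simple_roots D. 0 \<le> b' \<epsilon>) \<or> (\<forall>\<epsilon>\<in>simple_roots D. b' \<epsilon> \<le> 0)"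
    using simple_base[OF \<beta>] by blast
  \<comment> \<open>The sign alternative of \<open>simple_base\<close> concerns some coefficients
    \<open>b'\<close>; independence of the simple roots transfers it to the explicit
    \<open>b\<close>.\<close>
  have "b' \<epsilon> = b \<epsilon>" if "\<epsilon> \<in> simple_roots D" for \<epsilon>
    using simple_coefficients_unique[of b' b] b'(1) \<beta>sum that by metis
  then consider (pos) "\<forall>\<epsilon>\<in>simple_roots D. 0 \<le> b \<epsilon>" | (neg) "\<forall>\<epsilon>\<in>simple_roots D. b \<epsilon> \<le> 0"
    using b'(2) by force
  then show ?case
  proof cases
    case pos
    have "(\<Sum>\<epsilon>\<in>simple_roots D. b \<epsilon>) = (\<Sum>\<epsilon>\<in>simple_roots D. c \<epsilon>) - k"
      using sum.remove[OF finite_simple \<delta>(1), of b] sum.remove[OF finite_simple \<delta>(1), of c]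
      by (simp add: b_def)
    then have "nat (\<Sum>\<epsilon>\<in>simple_roots D. b \<epsilon>) < nat (\<Sum>\<epsilon>\<in>simple_roots D. c \<epsilon>)"
      using \<delta>(3) sum_nonneg[of "simple_roots D" b] pos unfolding k_def by auto
    from less.hyps[OF this \<beta> \<beta>sum pos] have "reflection D \<beta> \<in> simple_weyl" .
    moreover have "reflection D \<alpha> = reflection D \<delta> \<circ> reflection D \<beta> \<circ> reflection D \<delta>"
      using reflection_conjugate[OF reflection_weyl reflection_weyl reflection_involution_o, OF
          \<delta>root \<delta>root \<delta>root \<beta>]
      by (simp add: \<beta>_def reflection_involution[OF \<delta>root])
    ultimately show ?thesis using simple_weyl_comp simple_reflection[OF \<delta>(1)] by metis
  next
    case neg
    \<comment> \<open>Since \<open>b\<close> and \<open>c\<close> differ only at \<delta>, a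
      nonpositive \<open>b\<close> and a nonnegative \<open>c\<close> leave \<delta> as the only
      simple root in the sum.\<close>
    have "c \<epsilon> = 0" if "\<epsilon> \<in> simple_roots D - {\<delta>}" for \<epsilon>
      using neg nonneg that by (force simp: b_def split: if_splits)
    then have \<alpha>\<delta>: "\<alpha> = zscale (c \<delta>) \<delta>"
      using sum sum.remove[OF finite_simple \<delta>(1), of "\<lambda>\<epsilon>. zscale (c \<epsilon>) \<epsilon>"] by simp
    then have "\<delta> = \<alpha> \<or> \<delta> = - \<alpha>"
      using reduced[OF root \<delta>root, of 1 "c \<delta>"] by (simp add: zscale_one)
    moreover have "\<delta> \<noteq> - \<alpha>"
    proof
      assume "\<delta> = - \<alpha>"
      then have "zscale (c \<delta> + 1) \<delta> = 0" using \<alpha>\<delta> zscale_plus_one[of "c \<delta>" \<delta>]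
        by (metis add.right_inverse)
      then show False using torsion_free[of "c \<delta> + 1" \<delta>] \<delta>(2) root_nonzero[OF \<delta>root] by simp
    qed
    ultimately show ?thesis using simple_reflection[OF \<delta>(1)] by simp
  qed
qed

lemma reflection_in_simple_weyl:
  assumes "\<alpha> \<in> roots D" shows "reflection D \<alpha> \<in> simple_weyl"
proof -
  obtain c where c: "\<alpha> = (\<Sum>\<delta>\<in>simple_roots D. zscale (c \<delta>) \<delta>)"
     "(\<forall>\<delta>\<in>simple_roots D. 0 \<le> c \<delta>) \<or> (\<forall>\<delta>\<in>simple_roots D. c \<delta> \<le> 0)"
    using simple_base[OF assms] by blast
  show ?thesis
  proof (cases "\<forall>\<delta>\<in>simple_roots D. 0 \<le> c \<delta>")
    case True
    then show ?thesis using positive_root_reflection assms c by blast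
  next
    case False
    then have nonneg: "\<forall>\<delta>\<in>simple_roots D. 0 \<le> - c \<delta>" using c(2) by auto
    have minus: "- \<alpha> \<in> roots D"
      using reflection_self[OF assms] reflection_roots[OF assms] assms by (metis imageI)
    have "- \<alpha> = (\<Sum>\<delta>\<in>simple_roots D. zscale (- c \<delta>) \<delta>)"
      by (subst c(1)) (simp add: zscale_minus sum_negf)
    from positive_root_reflection[OF minus this nonneg]
    have "reflection D (- \<alpha>) \<in> simple_weyl" .
    \<comment> \<open>Conjugating the reflection in \<alpha> by itself gives the reflection in the
      image \<open>- \<alpha>\<close>; the product of three copies of an involution is that
      involution.\<close>
    moreover have "reflection D (- \<alpha>) = reflection D \<alpha>"
      using reflection_conjugate[OF reflection_weyl reflection_weyl reflection_involution_o, OF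
          assms assms assms assms]
      by (simp add: reflection_self[OF assms] reflection_involution_o[OF assms])
    ultimately show ?thesis by simp
  qed
qed

lemma simple_weyl_eq: "simple_weyl = weyl D"
proof
  have "word as \<in> weyl D" if "set as \<subseteq> simple_roots D" for as
    using that simple_subset
    by (induction as) (auto simp: word_Nil word_Cons intro: weyl.intros)
  then show "simple_weyl \<subseteq> weyl D" by (auto simp: simple_weyl_def)
  show "weyl D \<subseteq> simple_weyl"
  proof
    fix w assume "w \<in> weyl D"
    then show "w \<in> simple_weyl"
    proof (induction rule: weyl.induct)
      case weyl_id
      have "word [] \<in> simple_weyl"
        unfolding simple_weyl_def by (rule CollectI, rule exI[of _ "[]"]) simp
      then show ?case by (simp only: word_Nil)
    next
      case (weyl_reflection \<alpha> w)
      then show ?case using simple_weyl_comp reflection_in_simple_weyl by blast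
    qed
  qed
qed

lemma weyl_length_le:
  "set as \<subseteq> simple_roots D \<Longrightarrow> weyl_length D (word as) \<le> length as"
  unfolding weyl_length_def word_def[symmetric] by (rule Least_le) auto

text \<open>Generation by simple reflections makes the set under \<open>LEAST\<close> nonempty, so
  the minimum in the definition of the length is attained.\<close>

lemma weyl_length_reduced:
  assumes "w \<in> weyl D"
  shows "\<exists>as. length as = weyl_length D w \<and> set as \<subseteq> simple_roots D \<and>
    w = word as"
  unfolding weyl_length_def word_def[symmetric]
proof (rule LeastI_ex)
  have "w \<in> simple_weyl" using assms simple_weyl_eq by simp
  then show "\<exists>n as. length as = n \<and> set as \<subseteq> simple_roots D \<and>
      w = word as"
    unfolding simple_weyl_def by blast
qed

lemma weyl_length_id: "weyl_length D id = 0"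
  using weyl_length_le[of "[]"] by (simp add: word_Nil)

lemma weyl_length_simple:
  assumes "\<delta> \<in> simple_roots D" shows "weyl_length D (reflection D \<delta>) = 1"
proof -
  have \<delta>: "\<delta> \<in> roots D" using assms simple_subset by blast
  have "reflection D \<delta> \<noteq> id"
  proof
    assume "reflection D \<delta> = id"
    then have "\<delta> + \<delta> = 0" using reflection_self[OF \<delta>] by (simp add: eq_neg_iff_add_eq_0)
    then have "zscale 2 \<delta> = 0" using zscale_add_left[of 1 1 \<delta>] by (simp add: zscale_one)
    then show False using torsion_free[of 2 \<delta>] root_nonzero[OF \<delta>] by simp
  qed
  then have "weyl_length D (reflection D \<delta>) \<noteq> 0"
    using weyl_length_reduced[OF reflection_weyl[OF \<delta>]] word_Nil by force
  moreover have "weyl_length D (reflection D \<delta>) \<le> 1"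
    using weyl_length_le[of "[\<delta>]"] assms by (simp add: word_singleton)
  ultimately show ?thesis by simp
qed

text \<open>Remove the first letter of a reduced word: the rest is reduced too, since a shorter word
  for it would shorten the whole. The length equation handed to the step is exactly the premise of
  \<open>T_mult\<close>.\<close>

lemma weyl_length_induct [consumes 1, case_names id reflection]:
  assumes "w \<in> weyl D" and "P id"
    and step: "\<And>\<delta> w. \<lbrakk>\<delta> \<in> simple_roots D; w \<in> weyl D; P w;
      weyl_length D (reflection D \<delta> \<circ> w) = weyl_length D (reflection D \<delta>) + weyl_length D w\<rbrakk>
      \<Longrightarrow> P (reflection D \<delta> \<circ> w)"
  shows "P w"
  using assms(1)
proof (induction "weyl_length D w" arbitrary: w)
  case 0
  obtain as where "length as = weyl_length D w" "w = word as"
    using weyl_length_reduced[OF 0(2)] by blast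
  then show ?case using 0(1) assms(2) word_Nil by (metis length_0_conv)
next
  case (Suc n)
  obtain as where as: "length as = Suc n" "set as \<subseteq> simple_roots D"
      "w = word as"
    using weyl_length_reduced[OF Suc(3)] Suc(2) by metis
  then obtain \<delta> bs where bs: "as = \<delta> # bs" by (cases as) auto
  define v where "v = word bs"
  have w: "w = reflection D \<delta> \<circ> v" using as bs v_def word_Cons by simp
  have v: "v \<in> weyl D"
    using as(2) bs unfolding v_def simple_weyl_eq[symmetric] simple_weyl_def by auto
  have \<delta>: "\<delta> \<in> simple_roots D" using as bs by simp
  obtain cs where cs: "length cs = weyl_length D v" "set cs \<subseteq> simple_roots D"
      "v = word cs"
    using weyl_length_reduced[OF v] by metis
  have "weyl_length D v \<le> n" using weyl_length_le[of bs] as bs v_def by simp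
  moreover have "Suc n \<le> Suc (weyl_length D v)"
    using weyl_length_le[of "\<delta> # cs"] cs \<delta> w Suc(2) word_Cons by simp
  ultimately have "weyl_length D v = n" by simp
  then show ?case using step[OF \<delta> v] Suc(1)[of v] v w Suc(2) weyl_length_simple[OF \<delta>] by simp
qed

text \<open>The reversed word represents the inverse, which gives one inequality; applied to the
  inverse it gives the other.\<close>

lemma weyl_length_inv_into:
  assumes "w \<in> weyl D" shows "weyl_length D (inv_into UNIV w) = weyl_length D w"
proof -
  have le: "weyl_length D (inv_into UNIV w) \<le> weyl_length D w"
    if w: "w \<in> weyl D" for w
  proof -
    obtain as where as: "length as = weyl_length D w" "set as \<subseteq> simple_roots D"
      "w = word as"
      using weyl_length_reduced[OF w] by metis
    have "word (rev as) \<circ> word as = id"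
      using as(2)
    proof (induction as)
      case (Cons a as)
      have "reflection D a \<circ> (reflection D a \<circ> g) = g" for g :: "'x \<Rightarrow> 'x"
        using Cons.prems simple_subset by (auto simp: fun_eq_iff reflection_involution)
      then have "word (rev (a # as)) \<circ> word (a # as) = word (rev as) \<circ> word as"
        by (simp only: rev.simps word_append word_Cons word_Nil comp_id comp_assoc)
      then show ?case using Cons by simp
    qed (simp add: word_Nil)
    then have "inv_into UNIV w = word (rev as)"
      using as(3) weyl_bij[OF w]
      by (metis bij_is_surj comp_assoc comp_id id_comp surj_iff)
    then show ?thesis using weyl_length_le[of "rev as"] as by simp
  qed
  have "inv_into UNIV (inv_into UNIV w) = w" by (simp add: inv_inv_eq weyl_bij[OF assms])
  then show ?thesis
    using le[OF assms] le[OF weyl_inv_into[OF assms]] by simp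
qed

lemma longest_inv_into: "is_longest D w \<Longrightarrow> is_longest D (inv_into UNIV w)"
  by (simp add: is_longest_def weyl_inv_into weyl_length_inv_into)

end

section \<open>Comparison of the Weyl groups along an isogeny\<close>

context root_datum_isogeny
begin

text \<open>\<open>transpose_map\<close> is a definite description, and perfectness of the pairing
  of \<open>D1\<close> provides the unique element that it denotes; the axiom on coroots can then be
  evaluated.\<close>

lemma pairing_f:
  assumes "\<alpha> \<in> roots D1"
  shows "pairing D2 (f x) (coroot D2 (f \<alpha>)) = pairing D1 x (coroot D1 \<alpha>)"
proof -
  let ?\<phi> = "\<lambda>x. pairing D2 (f x) (coroot D2 (f \<alpha>))"
  have additive: "additive ?\<phi>"
    by (rule additive.intro) (simp only: additive.add[OF additive_f] D2.pairing_simps)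
  have ex: "\<forall>\<phi>. additive \<phi> \<longrightarrow> (\<exists>!y. \<phi> = (\<lambda>x. pairing D1 x y))"
    using D1.perfect unfolding perfect_pairing_def by (elim conjE)
  from spec[OF ex, of ?\<phi>] additive have "\<exists>!y. ?\<phi> = (\<lambda>x. pairing D1 x y)" by (rule mp)
  moreover have "?\<phi> = (\<lambda>x. pairing D1 x y) \<longleftrightarrow> (\<forall>x. pairing D1 x y = ?\<phi> x)" for y
    by (subst fun_eq_iff) (simp only: eq_commute[of "?\<phi> _"])
  ultimately have "\<exists>!y. \<forall>x. pairing D1 x y = ?\<phi> x" by simp
  then have "\<forall>x. pairing D1 x (transpose_map D1 D2 f (coroot D2 (f \<alpha>))) = ?\<phi> x"
    unfolding transpose_map_def by (rule theI')
  then show ?thesis using transpose_coroot[OF assms] by simp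
qed

lemma reflection_f: "\<alpha> \<in> roots D1 \<Longrightarrow> reflection D2 (f \<alpha>) (f x) = f (reflection D1 \<alpha> x)"
  by (simp add: reflection_def pairing_f additive.diff[OF additive_f] additive_zscale[OF
      additive_f])

lemma range_f_add: "x \<in> range f \<Longrightarrow> y \<in> range f \<Longrightarrow> x + y \<in> range f"
  by (auto simp: additive.add[OF additive_f, symmetric])

lemma range_f_minus: "x \<in> range f \<Longrightarrow> - x \<in> range f"
  by (auto simp: additive.minus[OF additive_f, symmetric])

lemma range_f_diff: "x \<in> range f \<Longrightarrow> y \<in> range f \<Longrightarrow> x - y \<in> range f"
  by (auto simp: additive.diff[OF additive_f, symmetric])

lemma range_f_zero: "0 \<in> range f"
  by (simp add: additive.zero[OF additive_f, symmetric])

lemma range_f_zscale: "x \<in> range f \<Longrightarrow> zscale k x \<in> range f"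
  by (auto simp: additive_zscale[OF additive_f, symmetric])

lemma range_f_root: "\<alpha> \<in> roots D2 \<Longrightarrow> \<alpha> \<in> range f"
  using f_roots by auto

lemma cokernel_eq: "cokernel f = range (\<lambda>x. {y. x - y \<in> range f})"
  by (auto simp: cokernel_def quotient_def)

lemma coset_eq_iff: "{z. x - z \<in> range f} = {z. y - z \<in> range f} \<longleftrightarrow> x - y \<in> range f"
proof
  assume "{z. x - z \<in> range f} = {z. y - z \<in> range f}"
  then show "x - y \<in> range f" using range_f_zero by auto
next
  assume xy: "x - y \<in> range f"
  have "x - z \<in> range f \<longleftrightarrow> y - z \<in> range f" for z
    using range_f_diff[OF _ xy, of "x - z"] range_f_add[OF xy, of "y - z"] by auto
  then show "{z. x - z \<in> range f} = {z. y - z \<in> range f}" by simp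
qed

text \<open>Pigeonhole: the multiples of \<open>x\<close> are indexed by infinitely many integers
  but fall into finitely many cosets, and the difference of two that share a coset is the multiple
  sought.\<close>

lemma multiple_in_range: "\<exists>n\<noteq>0. zscale n x \<in> range f"
proof -
  let ?K = "\<lambda>n::int. {y. zscale n x - y \<in> range f}"
  have "finite (range ?K)"
    by (rule finite_subset[OF _ finite_cokernel]) (auto simp: cokernel_eq)
  then have "\<not> inj ?K" using finite_imageD infinite_UNIV_int by blast
  then obtain m n where mn: "m \<noteq> n" "?K m = ?K n" unfolding inj_def by blast
  then have "zscale (m - n) x \<in> range f"
    unfolding coset_eq_iff by (simp add: int_module.scale_left_diff_distrib)
  then show ?thesis using mn(1) by (metis eq_iff_diff_eq_0)
qed

text \<open>A nonzero multiple of each point lies in \<open>range f\<close>, and torsion-freeness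
  cancels the multiplier. So a Weyl group element of \<open>D2\<close> is determined by its
  restriction along \<open>f\<close>.\<close>

lemma additive_eqI:
  assumes "additive v" "additive w" "v \<circ> f = w \<circ> f" shows "v = (w :: 'x2 \<Rightarrow> 'x2)"
proof
  fix x
  obtain n y where n: "n \<noteq> 0" "zscale n x = f y" using multiple_in_range[of x] by auto
  have "zscale n (v x - w x) = v (f y) - w (f y)"
    using n(2) additive_zscale[OF assms(1), of n x] additive_zscale[OF assms(2), of n x]
    by (simp add: int_module.scale_right_diff_distrib)
  also have "\<dots> = 0" using fun_cong[OF assms(3), of y] by simp
  finally show "v x = w x" using D2.torsion_free[OF _ n(1), of "v x - w x"] by simp
qed

text \<open>Generator by generator: the reflection in \<open>f \<alpha>\<close> restricts to the
  reflection in \<alpha>. As every root of \<open>D2\<close> has the form \<open>f \<alpha>\<close>,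
  the same argument serves for the descent.\<close>

lemma weyl_lift:
  assumes "w1 \<in> weyl D1" shows "\<exists>w2\<in>weyl D2. w2 \<circ> f = f \<circ> w1"
  using assms
proof (induction rule: weyl.induct)
  case weyl_id
  show ?case by (rule bexI[OF _ weyl.weyl_id]) simp
next
  case (weyl_reflection \<alpha> w)
  then obtain w2 where w2: "w2 \<in> weyl D2" "w2 \<circ> f = f \<circ> w" by blast
  have "(reflection D2 (f \<alpha>) \<circ> w2) \<circ> f = f \<circ> (reflection D1 \<alpha> \<circ> w)"
    using fun_cong[OF w2(2)] weyl_reflection(1) by (auto simp: fun_eq_iff reflection_f)
  moreover have "reflection D2 (f \<alpha>) \<circ> w2 \<in> weyl D2"
    using w2 weyl_reflection(1) f_roots by (blast intro: weyl.weyl_reflection)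
  ultimately show ?case by blast
qed

lemma weyl_descend:
  assumes "w2 \<in> weyl D2" shows "\<exists>w1\<in>weyl D1. w2 \<circ> f = f \<circ> w1"
  using assms
proof (induction rule: weyl.induct)
  case weyl_id
  show ?case by (rule bexI[OF _ weyl.weyl_id]) simp
next
  case (weyl_reflection \<beta> w)
  then obtain w1 where w1: "w1 \<in> weyl D1" "w \<circ> f = f \<circ> w1" by blast
  obtain \<alpha> where \<alpha>: "\<alpha> \<in> roots D1" "\<beta> = f \<alpha>" using weyl_reflection(1) f_roots by blast
  have "(reflection D2 \<beta> \<circ> w) \<circ> f = f \<circ> (reflection D1 \<alpha> \<circ> w1)"
    using fun_cong[OF w1(2)] \<alpha> by (auto simp: fun_eq_iff reflection_f)
  moreover have "reflection D1 \<alpha> \<circ> w1 \<in> weyl D1"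
    using w1 \<alpha> by (blast intro: weyl.weyl_reflection)
  ultimately show ?case by blast
qed

lemma word_f:
  "set as \<subseteq> roots D1 \<Longrightarrow> D2.word (map f as) \<circ> f = f \<circ> D1.word as"
proof (induction as)
  case Nil
  show ?case by (rule ext) (simp add: D1.word_Nil D2.word_Nil)
next
  case (Cons a as)
  then have a: "a \<in> roots D1" and as: "set as \<subseteq> roots D1" by auto
  show ?case
  proof
    fix x
    have "D2.word (map f as) (f x) = f (D1.word as x)" using fun_cong[OF Cons.IH[OF as], of x]
      by simp
    then show "(D2.word (map f (a # as)) \<circ> f) x = (f \<circ> D1.word (a # as)) x"
      by (simp add: D1.word_Cons D2.word_Cons reflection_f[OF a])
  qed
qed

text \<open>Since \<open>f\<close> matches the simple roots, reduced words can be carried in both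
  directions. That the carried word represents the right element follows from
  \<open>additive_eqI\<close> in one direction and from injectivity of \<open>f\<close> in the
  other.\<close>

lemma weyl_length_f:
  assumes w1: "w1 \<in> weyl D1" and w2: "w2 \<in> weyl D2" and eq: "w2 \<circ> f = f \<circ> w1"
  shows "weyl_length D2 w2 = weyl_length D1 w1"
proof (rule antisym)
  obtain as where as: "length as = weyl_length D1 w1" "set as \<subseteq> simple_roots D1" "w1 = D1.word as"
    using D1.weyl_length_reduced[OF w1] by blast
  have sub: "set (map f as) \<subseteq> simple_roots D2" using as(2) f_simple by auto
  have "D2.word (map f as) \<in> weyl D2"
    using sub unfolding D2.simple_weyl_eq[symmetric] D2.simple_weyl_def by blast
  moreover have "D2.word (map f as) \<circ> f = w2 \<circ> f"
    using word_f[of as] as eq D1.simple_subset by auto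
  ultimately have "w2 = D2.word (map f as)"
    using additive_eqI D2.weyl_additive w2 by metis
  then show "weyl_length D2 w2 \<le> weyl_length D1 w1"
    using D2.weyl_length_le[OF sub] as(1) by simp
next
  obtain bs where bs: "length bs = weyl_length D2 w2" "set bs \<subseteq> simple_roots D2" "w2 = D2.word bs"
    using D2.weyl_length_reduced[OF w2] by blast
  have "bs \<in> lists (f ` simple_roots D1)" using bs(2) f_simple by auto
  then have "\<exists>as. set as \<subseteq> simple_roots D1 \<and> bs = map f as"
    unfolding lists_image by auto
  then obtain as where as: "set as \<subseteq> simple_roots D1" "bs = map f as" by blast
  have "f \<circ> w1 = f \<circ> D1.word as"
    using word_f[of as] as bs eq D1.simple_subset by auto
  then have "w1 = D1.word as" using inj_f by (auto simp: fun_eq_iff inj_def)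
  then show "weyl_length D1 w1 \<le> weyl_length D2 w2"
    using D1.weyl_length_le[OF as(1)] as(2) bs(1) by simp
qed

text \<open>This makes \<open>star_theta\<close> for \<open>D2\<close> applicable to the lift of a
  longest element of \<open>D1\<close>, so that the two star operations can be compared.\<close>

lemma longest_f:
  assumes w1: "is_longest D1 w1" and w2: "w2 \<in> weyl D2" and eq: "w2 \<circ> f = f \<circ> w1"
  shows "is_longest D2 w2"
  unfolding is_longest_def
proof (intro conjI ballI w2)
  fix v2 assume v2: "v2 \<in> weyl D2"
  then obtain v1 where v1: "v1 \<in> weyl D1" "v2 \<circ> f = f \<circ> v1" using weyl_descend by blast
  have "weyl_length D1 v1 \<le> weyl_length D1 w1" using w1 v1(1) by (simp add: is_longest_def)
  then show "weyl_length D2 v2 \<le> weyl_length D2 w2"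
    using weyl_length_f[OF v1(1) v2 v1(2)] weyl_length_f[OF _ w2 eq] w1
    by (simp add: is_longest_def)
qed

lemma inv_into_f:
  assumes w1: "w1 \<in> weyl D1" and w2: "w2 \<in> weyl D2" and eq: "w2 \<circ> f = f \<circ> w1"
  shows "inv_into UNIV w2 \<circ> f = f \<circ> inv_into UNIV w1"
proof
  fix x
  have "w2 (f (inv_into UNIV w1 x)) = f x"
    using fun_cong[OF eq, of "inv_into UNIV w1 x"] D1.weyl_bij[OF w1]
    by (simp add: bij_is_surj surj_f_inv_f)
  then show "(inv_into UNIV w2 \<circ> f) x = (f \<circ> inv_into UNIV w1) x"
    using D2.weyl_bij[OF w2] by (metis bij_inv_eq_iff comp_apply)
qed

end

section \<open>Consequences of the Hecke algebra relations and the star axioms\<close>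

lemma unit_inverse_eq: "a * b = 1 \<Longrightarrow> b * a = 1 \<Longrightarrow> unit_inverse a = b"
  unfolding unit_inverse_def
    by (rule the_equality) (simp, metis mult.assoc mult_1_left mult_1_right)

context affine_hecke_algebra
begin

lemma hecke_induct [case_names zero add scale basis]:
  assumes "P 0" "\<And>a b. P a \<Longrightarrow> P b \<Longrightarrow> P (a + b)" "\<And>c a. P a \<Longrightarrow> P (c *\<^sub>C a)"
    and "\<And>x w. w \<in> weyl D \<Longrightarrow> P (\<theta> x * T w)"
  shows "P h"
proof -
  have "h \<in> complex_algebra.span ((\<lambda>(x, w). \<theta> x * T w) ` (UNIV \<times> weyl D))"
    using basis_span by simp
  then show ?thesis
    by (rule complex_algebra.span_induct) (use assms in \<open>auto intro!: complex_algebra.subspaceI\<close>)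
qed

text \<open>The relations do not mention the unit. On basis elements \<open>\<theta> 0\<close> acts
  as a left identity by \<open>theta_mult\<close>, hence it does so on 1.\<close>

lemma theta_zero: "\<theta> 0 = 1"
proof -
  have "\<theta> 0 * h = h" for h
    by (induction h rule: hecke_induct)
      (simp_all add: distrib_left mult_scaleC_right theta_mult mult.assoc[symmetric])
  from this[of 1] show ?thesis by simp
qed

lemma T_id: "T id = 1"
proof -
  have "h * T id = h" for h
  proof (induction h rule: hecke_induct)
    case (basis x w)
    then have "T w * T id = T w"
      using T_mult[OF basis weyl_id] by (simp add: weyl_length_id)
    then show ?case by (simp only: mult.assoc)
  qed (simp_all add: distrib_right mult_scaleC_left)
  from this[of 1] show ?thesis by simp
qed

lemma theta_minus: "\<theta> (- x) * \<theta> x = 1" "\<theta> x * \<theta> (- x) = 1"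
  by (simp_all add: theta_mult theta_zero)

text \<open>A geometric series: for positive \<open>k\<close> the quotient is the sum of
  \<open>\<theta> (x - zscale j \<gamma>)\<close> over \<open>0 \<le> j < k\<close>, and for
  negative \<open>k\<close> minus the sum over \<open>k \<le> j < 0\<close>. Recording that the
  exponents stay in \<open>x\<close> plus multiples of \<gamma> is what later fixes the degree of
  the quotient.\<close>

lemma theta_quotient:
  "\<exists>d\<in>complex_algebra.span (range (\<lambda>j. \<theta> (x + zscale j \<gamma>))).
     d * (1 - \<theta> (- \<gamma>)) = \<theta> x - \<theta> (x - zscale k \<gamma>)"
proof (induction k rule: int_induct[where k = 0])
  case base
  show ?case by (rule bexI[of _ 0]) (auto simp: complex_algebra.span_zero)
next
  case (step1 k)
  then obtain d where d: "d \<in> complex_algebra.span (range (\<lambda>j. \<theta> (x + zscale j \<gamma>)))"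
    "d * (1 - \<theta> (- \<gamma>)) = \<theta> x - \<theta> (x - zscale k \<gamma>)" by blast
  have "(d + \<theta> (x + zscale (- k) \<gamma>)) * (1 - \<theta> (- \<gamma>)) = \<theta> x - \<theta> (x - zscale (k + 1) \<gamma>)"
    unfolding distrib_right d(2)
    by (simp add: right_diff_distrib theta_mult zscale_minus zscale_plus_one algebra_simps)
  then show ?case using d(1) by (blast intro: complex_algebra.span_add complex_algebra.span_base)
next
  case (step2 k)
  then obtain d where d: "d \<in> complex_algebra.span (range (\<lambda>j. \<theta> (x + zscale j \<gamma>)))"
    "d * (1 - \<theta> (- \<gamma>)) = \<theta> x - \<theta> (x - zscale k \<gamma>)" by blast
  define e where "e = zscale (k - 1) \<gamma>"
  have k: "zscale k \<gamma> = e + \<gamma>" using zscale_plus_one[of "k - 1" \<gamma>] by (simp add: e_def)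
  have "(d - \<theta> (x + zscale (- (k - 1)) \<gamma>)) * (1 - \<theta> (- \<gamma>)) = \<theta> x - \<theta> (x - zscale (k - 1) \<gamma>)"
    unfolding left_diff_distrib[of d] d(2) zscale_minus k e_def[symmetric]
    by (simp add: right_diff_distrib theta_mult diff_diff_eq)
  then show ?case using d(1) by (blast intro: complex_algebra.span_diff complex_algebra.span_base)
qed

end

context hecke_star
begin

lemma star_simps:
  "star 1 = 1" "star (a + b) = star a + star b" "star (a * b) = star b * star a"
  "star (c *\<^sub>C a) = cnj c *\<^sub>C star a"
  using star_antiautomorphism by (auto simp: conj_linear_antiautomorphism_def)

lemma star_zero: "star 0 = 0"
  using star_simps(2)[of 0 0] by simp

text \<open>Applying \<open>star\<close> to \<open>\<theta> 0 = 1\<close> shows that \<open>T w0\<close> has a right inverse; applying it again to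
  this identity for the inverse of \<open>w0\<close> gives a left inverse.\<close>

lemma T_longest_unit:
  assumes "is_longest D w0"
  shows "T w0 * unit_inverse (T w0) = 1" "unit_inverse (T w0) * T w0 = 1"
proof -
  have right: "T w * unit_inverse (T w) = 1" if w: "is_longest D w" for w
  proof -
    have "w 0 = 0" using w additive.zero[OF weyl_additive] by (simp add: is_longest_def)
    then show ?thesis using star_theta[OF w, of 0] by (simp add: theta_zero star_simps)
  qed
  let ?v = "inv_into UNIV w0"
  have w0: "w0 \<in> weyl D" using assms by (simp add: is_longest_def)
  have "star (T ?v * unit_inverse (T ?v)) = 1"
    using right[OF longest_inv_into[OF assms]] star_simps(1) by simp
  then have left: "star (unit_inverse (T ?v)) * T w0 = 1"
    using star_T[OF weyl_inv_into[OF w0]] weyl_bij[OF w0] by (simp add: star_simps inv_inv_eq)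
  show "T w0 * unit_inverse (T w0) = 1" using right[OF assms] .
  then show "unit_inverse (T w0) * T w0 = 1"
    using left by (metis mult.assoc mult_1_left mult_1_right)
qed

text \<open>Involutivity is not part of \<open>hecke_star\<close>. Because
  \<open>star (T w0)\<close> is \<open>T v\<close> for the inverse \<open>v\<close> of
  \<open>w0\<close>, the formula for \<open>\<theta>\<close> is used at \<open>w0\<close> and then
  at \<open>v\<close>; the inverses \<open>star u\<close> and \<open>u'\<close> cancel against the
  two factors \<open>T v\<close>.\<close>

lemma star_star_theta: "star (star (\<theta> x)) = \<theta> x"
proof -
  obtain w0 where w0: "is_longest D w0" using longest_exists by blast
  define v where "v = inv_into UNIV w0"
  define u u' where "u = unit_inverse (T w0)" and "u' = unit_inverse (T v)"
  have v: "is_longest D v" unfolding v_def by (rule longest_inv_into[OF w0])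
  have weyl: "w0 \<in> weyl D" "v \<in> weyl D" using w0 v by (auto simp: is_longest_def)
  have "v (- w0 x) = - x"
    using weyl_bij[OF weyl(1)] additive.minus[OF weyl_additive[OF weyl(2)]]
    by (simp add: v_def bij_is_inj)
  then have "star (\<theta> (- w0 x)) = T v * \<theta> x * u'"
    using star_theta[OF v, of "- w0 x"] by (simp add: u'_def)
  moreover have "star (\<theta> x) = T w0 * \<theta> (- w0 x) * u" using star_theta[OF w0] by (simp add: u_def)
  ultimately have "star (star (\<theta> x)) = star u * (T v * \<theta> x * u') * T v"
    using star_T[OF weyl(1)] by (simp add: star_simps v_def mult.assoc)
  moreover have "star u * T v = 1"
    using T_longest_unit(1)[OF w0] star_T[OF weyl(1)]
    by (metis star_simps(1,3) u_def v_def)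
  moreover have "u' * T v = 1" using T_longest_unit(2)[OF v] by (simp add: u'_def)
  ultimately show ?thesis
    by (metis mult.assoc mult_1_left mult_1_right)
qed

lemma star_star: "star (star h) = h"
proof (induction h rule: hecke_induct)
  case (basis x w)
  then have "star (star (T w)) = T w"
    using star_T[OF basis] star_T[OF weyl_inv_into[OF basis]] weyl_bij[OF basis]
    by (simp add: inv_inv_eq)
  then show ?case by (simp add: star_simps star_star_theta)
qed (simp_all add: star_zero star_simps)

end

section \<open>The grading of an isogeny\<close>

lemma algebra_hom_simps:
  assumes "algebra_hom \<phi>"
  shows "\<phi> 1 = 1" "\<phi> (a + b) = \<phi> a + \<phi> b" "\<phi> (a * b) = \<phi> a * \<phi> b" "\<phi> (c *\<^sub>C a) = c *\<^sub>C \<phi> a"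
    "\<phi> 0 = 0"
proof -
  show "\<phi> 1 = 1" "\<phi> (a + b) = \<phi> a + \<phi> b" "\<phi> (a * b) = \<phi> a * \<phi> b" "\<phi> (c *\<^sub>C a) = c *\<^sub>C \<phi> a"
    using assms by (simp_all add: algebra_hom_def)
  have "\<phi> (0 + 0) = \<phi> 0 + \<phi> 0" using assms unfolding algebra_hom_def by blast
  then show "\<phi> 0 = 0" by simp
qed

context hecke_isogeny
begin

lemma range_f_minus_iff: "- x \<in> range f \<longleftrightarrow> x \<in> range f"
  using range_f_minus[of x] range_f_minus[of "- x"] by (simp only: minus_minus) argo

lemmas iota_simps = algebra_hom_simps[OF hom_iota]

lemma iota_T:
  assumes "w1 \<in> weyl D1" "w2 \<in> weyl D2" "w2 \<circ> f = f \<circ> w1" shows "\<iota> (T1 w1) = T2 w2"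
  using iota_basis[OF assms, of 0]
  by (simp add: H1.theta_zero H2.theta_zero additive.zero[OF additive_f])

lemma iota_theta: "\<iota> (\<theta>1 x) = \<theta>2 (f x)"
proof -
  have "id \<circ> f = f \<circ> id" by simp
  from iota_basis[OF weyl_id weyl_id this, of x] show ?thesis
    unfolding H1.T_id H2.T_id by simp
qed

lemma T2_in_range: "w \<in> weyl D2 \<Longrightarrow> T2 w \<in> range \<iota>"
  using iota_T weyl_descend by (metis rangeI)

lemma theta2_in_range: "x \<in> range f \<Longrightarrow> \<theta>2 x \<in> range \<iota>"
  using iota_theta by (metis rangeE rangeI)

text \<open>The graded component of the coset of \<open>x\<close>, encoded as a cyclic right module
  over \<open>range \<iota>\<close>. Stability under right multiplication is then immediate, and
  stability under left multiplication carries the content.\<close>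

definition homog :: "'x2 \<Rightarrow> 'h2 set" where
  "homog x = range (\<lambda>a. \<theta>2 x * \<iota> a)"

lemma homogI: "\<theta>2 x * \<iota> a \<in> homog x"
  by (simp add: homog_def)

lemma theta2_mult_range: "k \<in> range \<iota> \<Longrightarrow> \<theta>2 x * k \<in> homog x"
  by (elim rangeE) (simp add: homogI)

lemma theta2_homog: "\<theta>2 x \<in> homog x"
  using homogI[of x 1] by (simp add: iota_simps)

lemma homog_subspace: "complex_algebra.subspace (homog x)"
proof (rule complex_algebra.subspaceI)
  show "0 \<in> homog x" using homogI[of x 0] by (simp add: iota_simps)
  show "a + b \<in> homog x" if "a \<in> homog x" "b \<in> homog x" for a b
    using that homogI[of x] unfolding homog_def
    by (auto simp: iota_simps distrib_left[symmetric] simp flip: iota_simps(2))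
  show "c *\<^sub>C a \<in> homog x" if "a \<in> homog x" for a c
    using that homogI[of x] unfolding homog_def
    by (auto simp: mult_scaleC_right[symmetric] simp flip: iota_simps(4))
qed

lemmas homog_add = complex_algebra.subspace_add[OF homog_subspace]
lemmas homog_scale = complex_algebra.subspace_scale[OF homog_subspace]
lemmas homog_zero = complex_algebra.subspace_0[OF homog_subspace]

lemma homog_mult_iota: "h \<in> homog x \<Longrightarrow> h * \<iota> a \<in> homog x"
  by (auto simp: homog_def mult.assoc simp flip: iota_simps(3))

lemma theta2_mult_homog: "h \<in> homog x \<Longrightarrow> \<theta>2 y * h \<in> homog (y + x)"
  by (auto simp: homog_def mult.assoc[symmetric] H2.theta_mult)

lemma homog_shift:
  assumes "x - y \<in> range f" shows "homog x = homog y"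
proof -
  have "homog x \<subseteq> homog y" if xy: "x - y \<in> range f" for x y
  proof
    fix h assume "h \<in> homog x"
    then obtain a where a: "h = \<theta>2 x * \<iota> a" by (auto simp: homog_def)
    obtain z where z: "x - y = f z" using xy by auto
    have "\<theta>2 x = \<theta>2 y * \<iota> (\<theta>1 z)" by (simp add: iota_theta H2.theta_mult flip: z)
    then have "h = \<theta>2 y * \<iota> (\<theta>1 z * a)" by (simp add: a iota_simps mult.assoc)
    then show "h \<in> homog y" by (simp add: homogI)
  qed
  from this[of x y] this[of y x] show ?thesis
    using assms range_f_minus[OF assms] by auto
qed

lemma quotient_span_homog:
  assumes "d \<in> complex_algebra.span (range (\<lambda>j. \<theta>2 (x + zscale j \<gamma>)))" "\<gamma> \<in> range f"
  shows "d \<in> homog x"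
proof -
  have "homog (x + zscale j \<gamma>) = homog x" for j
    using range_f_zscale[OF assms(2)] by (intro homog_shift) simp
  then have "range (\<lambda>j. \<theta>2 (x + zscale j \<gamma>)) \<subseteq> homog x"
    using theta2_homog by blast
  then show ?thesis
    using complex_algebra.span_minimal[OF _ homog_subspace] assms(1) by blast
qed

text \<open>Every term of the cross relation has an exponent that differs from \<open>x\<close> by a
  multiple of \<delta>, and \<delta> lies in \<open>range f\<close>.\<close>

lemma T2_simple_theta2:
  assumes \<delta>: "\<delta> \<in> simple_roots D2"
  shows "T2 (reflection D2 \<delta>) * \<theta>2 x \<in> homog x"
proof -
  let ?s = "reflection D2 \<delta>"
  have root: "\<delta> \<in> roots D2" using \<delta> H2.simple_subset by blast
  have \<delta>f: "\<delta> \<in> range f" by (rule range_f_root[OF root])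
  have "homog (?s x) = homog x"
    using range_f_minus[OF range_f_zscale[OF \<delta>f]] by (intro homog_shift) (simp add: reflection_def)
  then have first: "\<theta>2 (?s x) * T2 ?s \<in> homog x"
    using theta2_mult_range[OF T2_in_range[OF H2.reflection_weyl[OF root]], of "?s x"] by simp
  have span_mono: "complex_algebra.span (range (\<lambda>j. \<theta>2 (x + zscale j \<gamma>))) \<subseteq> complex_algebra.span
      (range \<theta>2)" for \<gamma>
    by (rule complex_algebra.span_mono) auto
  show ?thesis
  proof (cases "coroot_even D2 \<delta>")
    case False
    obtain d where d: "d \<in> complex_algebra.span (range (\<lambda>j. \<theta>2 (x + zscale j \<delta>)))"
      "d * (1 - \<theta>2 (- \<delta>)) = \<theta>2 x - \<theta>2 (?s x)"
      using H2.theta_quotient[of x \<delta> "pairing D2 x (coroot D2 \<delta>)"] by (auto simp: reflection_def)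
    have "d \<in> homog x" by (rule quotient_span_homog[OF d(1) \<delta>f])
    then show ?thesis
      using H2.cross_relation[OF \<delta> False subsetD[OF span_mono d(1)] d(2)] first
      by (simp only: homog_add homog_scale)
  next
    case True
    then obtain y where y: "coroot D2 \<delta> = y + y" by (auto simp: coroot_even_def)
    \<comment> \<open>With the coroot equal to \<open>y + y\<close>, the pairing is even, so the
      reflection subtracts an integral multiple of \<open>\<delta> + \<delta>\<close>; this permits
      division by \<open>1 - \<theta>2 (- (\<delta> + \<delta>))\<close>.\<close>
    have s: "?s x = x - zscale (pairing D2 x y) (\<delta> + \<delta>)"
      by (simp only: reflection_def y H2.pairing_simps zscale_add_left zscale_add_right)
    obtain d where d: "d \<in> complex_algebra.span (range (\<lambda>j. \<theta>2 (x + zscale j (\<delta> + \<delta>))))"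
      "d * (1 - \<theta>2 (- (\<delta> + \<delta>))) = \<theta>2 x - \<theta>2 (?s x)"
      using H2.theta_quotient[of x "\<delta> + \<delta>" "pairing D2 x y"] unfolding s by blast
    have dx: "d \<in> homog x" by (rule quotient_span_homog[OF d(1) range_f_add[OF \<delta>f \<delta>f]])
    have "homog (- \<delta> + x) = homog x" using range_f_minus[OF \<delta>f] by (intro homog_shift) simp
    then have "\<theta>2 (- \<delta>) * d \<in> homog x" using theta2_mult_homog[OF dx] by metis
    then have "(c *\<^sub>C 1 + \<theta>2 (- \<delta>) * (c' *\<^sub>C 1)) * d \<in> homog x" for c c'
      using dx by (simp add: distrib_right mult_scaleC_left mult_scaleC_right homog_add homog_scale)
    then show ?thesis
      using H2.cross_relation_even[OF \<delta> True subsetD[OF span_mono d(1)] d(2)] first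
      by (simp only: homog_add)
  qed
qed

text \<open>Along a reduced word, each letter passes \<open>\<theta>2 x\<close> and leaves an
  element of \<open>range \<iota>\<close> on its right, which accumulates there.\<close>

lemma T2_theta2: "w \<in> weyl D2 \<Longrightarrow> T2 w * \<theta>2 x \<in> homog x"
proof (induction w rule: H2.weyl_length_induct)
  case id
  show ?case unfolding H2.T_id by (simp add: theta2_homog)
next
  case (reflection \<delta> w)
  have \<delta>: "\<delta> \<in> roots D2" using reflection(1) H2.simple_subset by blast
  obtain a where a: "T2 w * \<theta>2 x = \<theta>2 x * \<iota> a" using reflection.IH by (auto simp: homog_def)
  have "T2 (reflection D2 \<delta> \<circ> w) * \<theta>2 x = (T2 (reflection D2 \<delta>) * \<theta>2 x) * \<iota> a"
    using H2.T_mult[OF H2.reflection_weyl[OF \<delta>] reflection(2,3)] a by (metis mult.assoc)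
  then show ?case using homog_mult_iota[OF T2_simple_theta2[OF reflection(1)]] by (simp only:)
qed

text \<open>Each component is thus a bimodule: passing \<open>T2 w2\<close> keeps the coset by
  \<open>T2_theta2\<close>, and \<open>\<theta>2 (f y)\<close> shifts the exponent within
  it.\<close>

lemma iota_mult_homog:
  assumes "h \<in> homog x" shows "\<iota> a * h \<in> homog x"
proof (induction a rule: H1.hecke_induct)
  case zero
  show ?case by (simp add: iota_simps homog_zero)
next
  case (add a b)
  then show ?case by (simp add: iota_simps distrib_right homog_add)
next
  case (scale c a)
  then show ?case by (simp add: iota_simps mult_scaleC_left homog_scale)
next
  case (basis y w1)
  obtain w2 where w2: "w2 \<in> weyl D2" "w2 \<circ> f = f \<circ> w1" using weyl_lift[OF basis] by blast
  obtain b where b: "h = \<theta>2 x * \<iota> b" using assms by (auto simp: homog_def)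
  have "T2 w2 * h \<in> homog x"
    using homog_mult_iota[OF T2_theta2[OF w2(1)], of x b] by (simp add: b mult.assoc)
  then have "\<theta>2 (f y) * (T2 w2 * h) \<in> homog (f y + x)" by (rule theta2_mult_homog)
  moreover have "homog (f y + x) = homog x" by (rule homog_shift) simp
  ultimately show ?case using iota_basis[OF basis w2, of y] by (simp add: mult.assoc)
qed

lemma homog_mult_theta2:
  assumes "h \<in> homog x" shows "h * \<theta>2 y \<in> homog (x + y)"
proof -
  obtain a where "h = \<theta>2 x * \<iota> a" using assms by (auto simp: homog_def)
  then show ?thesis
    using theta2_mult_homog[OF iota_mult_homog[OF theta2_homog]] by (simp add: mult.assoc)
qed

lemma basis_homog: "w \<in> weyl D2 \<Longrightarrow> \<theta>2 x * T2 w \<in> homog x"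
  by (rule theta2_mult_range[OF T2_in_range])

text \<open>Expanding the right factor in the basis of the small algebra turns
  \<open>\<theta>2 x * \<iota> a\<close> into basis elements of the large one, with exponents in the
  coset of \<open>x\<close>.\<close>

lemma homog_induct [consumes 1, case_names zero add scale basis]:
  assumes "h \<in> homog x"
    and "P 0" "\<And>a b. P a \<Longrightarrow> P b \<Longrightarrow> P (a + b)" "\<And>c a. P a \<Longrightarrow> P (c *\<^sub>C a)"
    and basis: "\<And>y w. w \<in> weyl D2 \<Longrightarrow> x - y \<in> range f \<Longrightarrow> P (\<theta>2 y * T2 w)"
  shows "P h"
proof -
  obtain a where a: "h = \<theta>2 x * \<iota> a" using assms(1) by (auto simp: homog_def)
  have "P (\<theta>2 x * \<iota> a)"
  proof (induction a rule: H1.hecke_induct)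
    case (basis y w1)
    obtain w2 where w2: "w2 \<in> weyl D2" "w2 \<circ> f = f \<circ> w1" using weyl_lift[OF basis] by blast
    have "\<theta>2 x * \<iota> (\<theta>1 y * T1 w1) = \<theta>2 (x + f y) * T2 w2"
      by (simp add: iota_basis[OF basis w2] mult.assoc[symmetric] H2.theta_mult)
    then show ?case using assms(5)[OF w2(1), of "x + f y"] range_f_minus[of "f y"] by simp
  qed (simp_all add: iota_simps distrib_left mult_scaleC_right assms)
  then show ?thesis by (simp add: a)
qed

lemma graded_component_eq: "graded_component D2 \<theta>2 T2 {y. x - y \<in> range f} = homog x"
proof
  show "graded_component D2 \<theta>2 T2 {y. x - y \<in> range f} \<subseteq> homog x"
    unfolding graded_component_def
  proof (rule complex_algebra.span_minimal[OF _ homog_subspace], clarify)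
    fix y z w assume "x - y = f z" "w \<in> weyl D2"
    then show "\<theta>2 y * T2 w \<in> homog x" using basis_homog homog_shift by (metis rangeI)
  qed
  show "homog x \<subseteq> graded_component D2 \<theta>2 T2 {y. x - y \<in> range f}"
  proof
    fix h assume "h \<in> homog x"
    then show "h \<in> graded_component D2 \<theta>2 T2 {y. x - y \<in> range f}"
      unfolding graded_component_def
      by (induction rule: homog_induct)
        (auto intro: complex_algebra.span_zero complex_algebra.span_add complex_algebra.span_scale
          complex_algebra.span_base)
  qed
qed

section \<open>The projection to degree zero and its dual bases\<close>

definition proj :: "'h2 \<Rightarrow> 'h2" where
  "proj = (SOME g. Vector_Spaces.linear scaleC scaleC g \<and>
     (\<forall>x. \<forall>w\<in>weyl D2. g (\<theta>2 x * T2 w) = (if x \<in> range f then \<theta>2 x * T2 w else 0)))"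

text \<open>Linear extension from the basis. The values are prescribed as a function of the product
  \<open>\<theta>2 x * T2 w\<close>, so the degree of \<open>x\<close> has to be read back from the
  product, by injectivity of the basis family.\<close>

lemma proj_exists:
  "\<exists>g. Vector_Spaces.linear scaleC scaleC g \<and>
     (\<forall>x. \<forall>w\<in>weyl D2. g (\<theta>2 x * T2 w) = (if x \<in> range f then \<theta>2 x * T2 w else 0))"
proof -
  interpret vector_space_pair "scaleC :: complex \<Rightarrow> 'h2 \<Rightarrow> 'h2" "scaleC :: complex \<Rightarrow> 'h2 \<Rightarrow> 'h2"
    by standard
  let ?b = "\<lambda>(x, w). \<theta>2 x * T2 w"
  let ?h = "\<lambda>b. if b \<in> ?b ` (range f \<times> weyl D2) then b else 0"
  obtain g where g: "Vector_Spaces.linear scaleC scaleC g"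
      "\<forall>b\<in>?b ` (UNIV \<times> weyl D2). g b = ?h b"
    using linear_independent_extend[OF H2.basis_independent, of ?h] by blast
  have "g (\<theta>2 x * T2 w) = (if x \<in> range f then \<theta>2 x * T2 w else 0)" if w: "w \<in> weyl D2" for x w
  proof -
    have "\<theta>2 x * T2 w \<in> ?b ` (range f \<times> weyl D2) \<longleftrightarrow> x \<in> range f"
    proof
      assume "\<theta>2 x * T2 w \<in> ?b ` (range f \<times> weyl D2)"
      then obtain p where p: "p \<in> range f \<times> weyl D2" "?b (x, w) = ?b p" by auto
      then have "p = (x, w)" using inj_onD[OF H2.basis_inj p(2)] w by auto
      then show "x \<in> range f" using p(1) by blast
    qed (use w in auto)
    moreover have "g (\<theta>2 x * T2 w) = ?h (\<theta>2 x * T2 w)"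
      by (rule bspec[OF g(2)]) (use w in auto)
    ultimately show ?thesis by simp
  qed
  then show ?thesis using g(1) by blast
qed

lemma
  proj_linear: "Vector_Spaces.linear scaleC scaleC proj" and
  proj_basis: "w \<in> weyl D2 \<Longrightarrow> proj (\<theta>2 x * T2 w) = (if x \<in> range f then \<theta>2 x * T2 w else 0)"
  using someI_ex[OF proj_exists] unfolding proj_def[symmetric] by auto

lemma proj_simps: "proj (a + b) = proj a + proj b" "proj (c *\<^sub>C a) = c *\<^sub>C proj a" "proj 0 = 0"
proof -
  interpret Vector_Spaces.linear "scaleC :: complex \<Rightarrow> 'h2 \<Rightarrow> 'h2" "scaleC :: complex \<Rightarrow> 'h2 \<Rightarrow> 'h2"
      proj
    by (rule proj_linear)
  show "proj (a + b) = proj a + proj b" "proj (c *\<^sub>C a) = c *\<^sub>C proj a" "proj 0 = 0"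
    by (simp_all add: add scale zero)
qed

lemma proj_sum: "proj (sum g A) = (\<Sum>i\<in>A. proj (g i))"
  by (rule additive.sum) (simp add: additive_def proj_simps)

lemma proj_homog:
  assumes "h \<in> homog x" shows "proj h = (if x \<in> range f then h else 0)"
  using assms
proof (induction rule: homog_induct)
  case (basis y w)
  have "x \<in> range f \<longleftrightarrow> y \<in> range f"
    using range_f_add[OF basis(2), of y] range_f_diff[OF _ basis(2), of x] by auto
  then show ?case by (simp add: proj_basis[OF basis(1)])
qed (simp_all add: proj_simps)

lemma proj_in_range: "proj h \<in> range \<iota>"
proof -
  have range: "range \<iota> = homog 0"
    unfolding homog_def by (simp add: H2.theta_zero)
  show ?thesis
  proof (induction h rule: H2.hecke_induct)
    case (basis x w)
    show ?case
    proof (cases "x \<in> range f")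
      case True
      then have "homog x = homog 0" by (intro homog_shift) simp
      then show ?thesis using basis_homog[OF basis, of x]
        by (simp add: proj_basis[OF basis] True range)
    qed (simp add: proj_basis[OF basis] range homog_zero)
  qed (simp_all add: proj_simps range homog_zero homog_add homog_scale)
qed

definition cond_exp :: "'h2 \<Rightarrow> 'h1" where
  "cond_exp h = inv_into UNIV \<iota> (proj h)"

lemma iota_cond_exp: "\<iota> (cond_exp h) = proj h"
  unfolding cond_exp_def by (rule f_inv_into_f[OF proj_in_range])

lemma cond_exp_add: "cond_exp (a + b) = cond_exp a + cond_exp b"
  by (rule injD[OF inj_iota]) (simp add: iota_cond_exp iota_simps proj_simps)

lemma proj_iota_mult: "proj (\<iota> a * h) = \<iota> a * proj h"
proof (induction h rule: H2.hecke_induct)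
  case (basis x w)
  show ?case
    using proj_homog[OF iota_mult_homog[OF basis_homog[OF basis]]] proj_basis[OF basis] by simp
qed (simp_all add: proj_simps distrib_left mult_scaleC_right)

lemma proj_mult_iota: "proj (h * \<iota> a) = proj h * \<iota> a"
proof (induction h rule: H2.hecke_induct)
  case (basis x w)
  show ?case
    using proj_homog[OF homog_mult_iota[OF basis_homog[OF basis]]] proj_basis[OF basis] by simp
qed (simp_all add: proj_simps distrib_right mult_scaleC_left)

lemma cond_exp_iota_mult: "cond_exp (\<iota> a * h) = a * cond_exp h"
  by (rule injD[OF inj_iota]) (simp add: iota_cond_exp iota_simps proj_iota_mult)

lemma cond_exp_mult_iota: "cond_exp (h * \<iota> a) = cond_exp h * a"
  by (rule injD[OF inj_iota]) (simp add: iota_cond_exp iota_simps proj_mult_iota)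

definition repr :: "'x2 set \<Rightarrow> 'x2" where
  "repr g = (SOME x. g = {y. x - y \<in> range f})"

lemma repr: "g \<in> cokernel f \<Longrightarrow> {y. repr g - y \<in> range f} = g"
  unfolding cokernel_eq repr_def by (rule someI2_ex[of "\<lambda>x. g = {y. x - y \<in> range f}"]) auto

lemma repr_diff_in_range_iff:
  assumes "g \<in> cokernel f" shows "x - repr g \<in> range f \<longleftrightarrow> g = {y. x - y \<in> range f}"
  using coset_eq_iff[of x "repr g"] repr[OF assms] by auto

text \<open>Exactly one coset contains \<open>x\<close>, so the sum collapses to a single term; on a
  basis element both expansions have this shape.\<close>

lemma sum_cokernel_delta:
  assumes "\<And>g. g \<in> cokernel f \<Longrightarrow> F g = (if x - repr g \<in> range f then c else (0::'h2))"
  shows "(\<Sum>g\<in>cokernel f. F g) = c"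
proof -
  have "(\<Sum>g\<in>cokernel f. F g) = (\<Sum>g\<in>cokernel f. if g = {y. x - y \<in> range f} then c else 0)"
    using assms by (intro sum.cong refl) (simp add: repr_diff_in_range_iff)
  also have "\<dots> = c" using finite_cokernel by (simp add: cokernel_eq)
  finally show ?thesis .
qed

lemma left_expansion: "h = (\<Sum>g\<in>cokernel f. \<theta>2 (repr g) * \<iota> (cond_exp (\<theta>2 (- repr g) * h)))"
proof (induction h rule: H2.hecke_induct)
  case (basis x w)
  have "(\<Sum>g\<in>cokernel f. \<theta>2 (repr g) * proj (\<theta>2 (- repr g) * (\<theta>2 x * T2 w))) = \<theta>2 x * T2 w"
  proof (rule sum_cokernel_delta[where x = x])
    fix g assume "g \<in> cokernel f"
    have "\<theta>2 (- repr g) * (\<theta>2 x * T2 w) \<in> homog (- repr g + x)"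
      by (rule theta2_mult_homog[OF basis_homog[OF basis]])
    moreover have "\<theta>2 (repr g) * (\<theta>2 (- repr g) * (\<theta>2 x * T2 w)) = \<theta>2 x * T2 w"
      by (simp add: mult.assoc[symmetric] H2.theta_minus)
    ultimately show "\<theta>2 (repr g) * proj (\<theta>2 (- repr g) * (\<theta>2 x * T2 w)) =
        (if x - repr g \<in> range f then \<theta>2 x * T2 w else 0)"
      by (simp add: proj_homog)
  qed
  then show ?case by (simp add: iota_cond_exp)
next
  case (add a b)
  then show ?case by (simp add: iota_cond_exp distrib_left proj_simps sum.distrib)
next
  case (scale c a)
  then show ?case
    by (simp add: iota_cond_exp mult_scaleC_right proj_simps
        complex_algebra.scale_sum_right[symmetric])
qed (simp add: iota_cond_exp proj_simps)

lemma right_expansion: "h = (\<Sum>g\<in>cokernel f. \<iota> (cond_exp (h * \<theta>2 (repr g))) * \<theta>2 (- repr g))"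
proof (induction h rule: H2.hecke_induct)
  case (basis x w)
  have "(\<Sum>g\<in>cokernel f. proj ((\<theta>2 x * T2 w) * \<theta>2 (repr g)) * \<theta>2 (- repr g)) = \<theta>2 x * T2 w"
  \<comment> \<open>The product with \<open>\<theta>2 (repr g)\<close> has degree
    \<open>x + repr g\<close>, which vanishes for the coset of \<open>- x\<close>; for the left
    expansion the surviving coset is that of \<open>x\<close>.\<close>
  proof (rule sum_cokernel_delta[where x = "- x"])
    fix g assume "g \<in> cokernel f"
    have "(\<theta>2 x * T2 w) * \<theta>2 (repr g) \<in> homog (x + repr g)"
      by (rule homog_mult_theta2[OF basis_homog[OF basis]])
    moreover have "x + repr g \<in> range f \<longleftrightarrow> - x - repr g \<in> range f"
      using range_f_minus_iff[of "x + repr g"] by (simp add: add.commute)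
    moreover have "((\<theta>2 x * T2 w) * \<theta>2 (repr g)) * \<theta>2 (- repr g) = \<theta>2 x * T2 w"
      by (simp add: mult.assoc H2.theta_minus)
    ultimately show "proj ((\<theta>2 x * T2 w) * \<theta>2 (repr g)) * \<theta>2 (- repr g) =
        (if - x - repr g \<in> range f then \<theta>2 x * T2 w else 0)"
      by (simp add: proj_homog)
  qed
  then show ?case by (simp add: iota_cond_exp)
next
  case (add a b)
  then show ?case by (simp add: iota_cond_exp distrib_right proj_simps sum.distrib)
next
  case (scale c a)
  then show ?case
    by (simp add: iota_cond_exp mult_scaleC_left proj_simps
        complex_algebra.scale_sum_right[symmetric])
qed (simp add: iota_cond_exp proj_simps)

text \<open>The left expansion is itself a homogeneous decomposition, which settles existence. For
  uniqueness, \<open>proj\<close> applied to any homogeneous decomposition annihilates all summands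
  except the one at \<open>range f\<close>.\<close>

lemma degree_zero_projection_eq: "degree_zero_projection D2 \<theta>2 T2 f \<iota> h = cond_exp h"
  unfolding degree_zero_projection_def
proof (rule the_equality)
  have zero: "range f = {y. 0 - y \<in> range f}"
    by (simp only: diff_0 range_f_minus_iff Collect_mem_eq)
  have zero_in: "range f \<in> cokernel f" unfolding cokernel_eq using zero by blast
  have comp: "graded_component D2 \<theta>2 T2 g = homog (repr g)" if "g \<in> cokernel f" for g
    using graded_component_eq[of "repr g"] repr[OF that] by simp
  have repr0: "repr g \<in> range f \<longleftrightarrow> g = range f" if "g \<in> cokernel f" for g
    using repr_diff_in_range_iff[OF that, of 0] zero range_f_minus_iff[of "repr g"] by simp
  let ?d = "\<lambda>g. \<theta>2 (repr g) * \<iota> (cond_exp (\<theta>2 (- repr g) * h))"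
  \<comment> \<open>The representative of the trivial coset need not be 0; it lies in
    \<open>range f\<close>, so its \<open>\<theta>2\<close> can be pulled through
    \<open>proj\<close> and cancelled.\<close>
  have "\<theta>2 (repr (range f)) \<in> range \<iota>" "\<theta>2 (- repr (range f)) \<in> range \<iota>"
    using theta2_in_range repr0[OF zero_in] range_f_minus by auto
  then obtain a b where ab: "\<theta>2 (repr (range f)) = \<iota> a" "\<theta>2 (- repr (range f)) = \<iota> b" by blast
  have "?d (range f) = (\<iota> a * \<iota> b) * proj h"
    by (simp add: iota_cond_exp ab proj_iota_mult mult.assoc)
  also have "\<dots> = proj h" by (simp add: ab[symmetric] H2.theta_minus)
  finally have "\<iota> (cond_exp h) = ?d (range f)" by (simp add: iota_cond_exp)
  then show "\<exists>d. (\<forall>g\<in>cokernel f. d g \<in> graded_component D2 \<theta>2 T2 g) \<and>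
      h = (\<Sum>g\<in>cokernel f. d g) \<and> \<iota> (cond_exp h) = d (range f)"
    using left_expansion[of h] comp homogI by (intro exI[of _ ?d]) simp
  fix a assume "\<exists>d. (\<forall>g\<in>cokernel f. d g \<in> graded_component D2 \<theta>2 T2 g) \<and>
      h = (\<Sum>g\<in>cokernel f. d g) \<and> \<iota> a = d (range f)"
  then obtain d where d: "\<And>g. g \<in> cokernel f \<Longrightarrow> d g \<in> homog (repr g)"
      "h = (\<Sum>g\<in>cokernel f. d g)" "\<iota> a = d (range f)"
    using comp by auto
  have "proj h = (\<Sum>g\<in>cokernel f. if g = range f then d g else 0)"
    unfolding d(2) proj_sum by (intro sum.cong refl) (simp add: proj_homog[OF d(1)] repr0)
  also have "\<dots> = d (range f)" using finite_cokernel zero_in by simp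
  finally show "a = cond_exp h"
    using d(3) by (intro injD[OF inj_iota]) (simp add: iota_cond_exp)
qed

end

locale star_isogeny = hecke_isogeny +
  S1: hecke_star D1 q lam1 lams1 \<theta>1 T1 star1 + S2: hecke_star D2 q lam2 lams2 \<theta>2 T2 star2
  for star1 star2
begin

text \<open>It suffices to compare on the factors \<open>T\<close> and \<open>\<theta>\<close>. A
  longest element lifts to a longest element, and \<open>\<iota>\<close> carries the inverse of its
  \<open>T\<close> to the inverse upstairs, so the two formulas for \<open>\<theta>\<close> agree
  factor by factor.\<close>

lemma star2_iota: "star2 (\<iota> a) = \<iota> (star1 a)"
proof (induction a rule: H1.hecke_induct)
  case (basis x w1)
  obtain w2 where w2: "w2 \<in> weyl D2" "w2 \<circ> f = f \<circ> w1" using weyl_lift[OF basis] by blast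
  have "star2 (T2 w2) = \<iota> (star1 (T1 w1))"
    unfolding S1.star_T[OF basis] S2.star_T[OF w2(1)]
    by (rule iota_T[symmetric, OF H1.weyl_inv_into[OF basis] H2.weyl_inv_into[OF w2(1)]
      inv_into_f[OF basis w2]])
  moreover have "star2 (\<theta>2 (f x)) = \<iota> (star1 (\<theta>1 x))"
  proof -
    obtain w0 where w0: "is_longest D1 w0" using H1.longest_exists by blast
    then have w0W: "w0 \<in> weyl D1" by (simp add: is_longest_def)
    obtain v0 where v0: "v0 \<in> weyl D2" "v0 \<circ> f = f \<circ> w0" using weyl_lift[OF w0W] by blast
    have T: "\<iota> (T1 w0) = T2 v0" by (rule iota_T[OF w0W v0])
    have "T2 v0 * \<iota> (unit_inverse (T1 w0)) = 1" "\<iota> (unit_inverse (T1 w0)) * T2 v0 = 1"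
      using S1.T_longest_unit[OF w0] by (simp_all add: iota_simps flip: T iota_simps(3))
    then have "unit_inverse (T2 v0) = \<iota> (unit_inverse (T1 w0))" by (rule unit_inverse_eq)
    moreover have "- v0 (f x) = f (- w0 x)"
      using fun_cong[OF v0(2), of x] by (simp add: additive.minus[OF additive_f])
    ultimately show ?thesis
      unfolding S1.star_theta[OF w0] S2.star_theta[OF longest_f[OF w0 v0]]
      by (simp add: iota_simps T iota_theta)
  qed
  ultimately show ?case
    by (simp add: iota_basis[OF basis w2] S1.star_simps S2.star_simps iota_simps
      iota_T[OF basis w2] iota_theta)
qed (simp_all add: iota_simps S1.star_simps S2.star_simps S1.star_zero S2.star_zero)

end

section \<open>Induced modules\<close>

locale induction_data = left_module M
  for M :: "('h1::ring_1, 'v) module" (structure) +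
  fixes \<iota> :: "'h1 \<Rightarrow> 'h2::ring_1"
begin

abbreviation free :: "('h2 \<times> 'v \<Rightarrow>\<^sub>0 int) monoid" where
  "free \<equiv> tensor_free M"

abbreviation rels :: "('h2 \<times> 'v \<Rightarrow>\<^sub>0 int) set" where
  "rels \<equiv> tensor_relations \<iota> M"

abbreviation Ind :: "('h2, ('h2 \<times> 'v \<Rightarrow>\<^sub>0 int) set) module" where
  "Ind \<equiv> induced_module \<iota> M"

definition formal :: "('h2 \<times> 'v \<Rightarrow>\<^sub>0 int) set" where
  "formal = {z. Poly_Mapping.keys z \<subseteq> UNIV \<times> carrier M}"

definition cls :: "('h2 \<times> 'v \<Rightarrow>\<^sub>0 int) \<Rightarrow> ('h2 \<times> 'v \<Rightarrow>\<^sub>0 int) set" where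
  "cls z = rels #>\<^bsub>free\<^esub> z"

definition generators :: "('h2 \<times> 'v \<Rightarrow>\<^sub>0 int) set" where
  "generators =
     {frag_of (a + b, v) - frag_of (a, v) - frag_of (b, v) | a b v. v \<in> carrier M} \<union>
     {frag_of (a, u \<oplus> v) - frag_of (a, u) - frag_of (a, v) | a u v. u \<in> carrier M \<and> v \<in> carrier M} \<union>
     {frag_of (a * \<iota> h, v) - frag_of (a, h \<odot> v) | a h v. v \<in> carrier M}"

lemma rels_eq: "rels = generate free generators"
  by (simp add: tensor_relations_def generators_def)

lemma carrier_free: "carrier free = formal"
  by (auto simp: tensor_free_def formal_def)

lemma formal_simps:
  "0 \<in> formal" "frag_of (a, v) \<in> formal \<longleftrightarrow> v \<in> carrier M"
  "x \<in> formal \<Longrightarrow> y \<in> formal \<Longrightarrow> x + y \<in> formal"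
  "x \<in> formal \<Longrightarrow> y \<in> formal \<Longrightarrow> x - y \<in> formal"
  "x \<in> formal \<Longrightarrow> - x \<in> formal"
  using keys_add[of x y] keys_diff[of x y] by (auto simp: keys_minus formal_def)

lemma generators_formal: "generators \<subseteq> formal"
proof
  fix x assume "x \<in> generators"
  then show "x \<in> formal"
    unfolding generators_def
    by (elim UnE CollectE exE conjE; hypsubst; intro formal_simps(4))
      (simp_all add: formal_simps smult_closed)
qed

lemma rels_subgroup: "subgroup rels free"
proof -
  have "group free" by (simp add: tensor_free_def)
  then show ?thesis unfolding rels_eq
    by (rule group.generate_is_subgroup) (simp only: carrier_free generators_formal)
qed

lemma rels_formal: "x \<in> rels \<Longrightarrow> x \<in> formal"
  using subgroup.subset[OF rels_subgroup] unfolding carrier_free by blast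

lemma rels_zero: "0 \<in> rels"
  using subgroup.one_closed[OF rels_subgroup] by (simp add: tensor_free_def)

lemma rels_add: "x \<in> rels \<Longrightarrow> y \<in> rels \<Longrightarrow> x + y \<in> rels"
  using subgroup.m_closed[OF rels_subgroup, of x y] by (simp add: tensor_free_def)

lemma rels_minus: "x \<in> rels \<Longrightarrow> - x \<in> rels"
  using subgroup.m_inv_closed[OF rels_subgroup, of x] rels_formal[of x]
  by (simp add: tensor_free_def formal_def)

lemma rels_diff: "x \<in> rels \<Longrightarrow> y \<in> rels \<Longrightarrow> x - y \<in> rels"
  using rels_add[of x "- y"] rels_minus[of y] by simp

lemma rels_induct [consumes 1, case_names zero incl minus add]:
  assumes "x \<in> rels" and "P 0" and "\<And>x. x \<in> generators \<Longrightarrow> P x"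
    and "\<And>x. x \<in> generators \<Longrightarrow> P (- x)"
    and "\<And>x y. x \<in> rels \<Longrightarrow> y \<in> rels \<Longrightarrow> P x \<Longrightarrow> P y \<Longrightarrow> P (x + y)"
  shows "P x"
  using assms(1) unfolding rels_eq
proof (induction rule: generate.induct)
  case (inv h)
  then have "h \<in> formal" using generators_formal by blast
  then show ?case using assms(4)[OF inv] by (simp add: tensor_free_def formal_def)
qed (use assms in \<open>auto simp: tensor_free_def rels_eq\<close>)

lemma in_cls_iff: "y \<in> cls z \<longleftrightarrow> y - z \<in> rels"
proof
  assume "y \<in> cls z"
  then show "y - z \<in> rels" by (auto simp: cls_def r_coset_def tensor_free_def)
next
  assume "y - z \<in> rels"
  then show "y \<in> cls z"
    by (auto simp: cls_def r_coset_def tensor_free_def intro!: bexI[of _ "y - z"])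
qed

lemma cls_eq_iff: "cls y = cls z \<longleftrightarrow> y - z \<in> rels"
proof
  assume "cls y = cls z"
  then show "y - z \<in> rels" using in_cls_iff[of y y] in_cls_iff[of y z] rels_zero by simp
next
  assume yz: "y - z \<in> rels"
  have "x - y \<in> rels \<longleftrightarrow> x - z \<in> rels" for x
    using rels_add[OF _ yz, of "x - y"] rels_diff[OF _ yz, of "x - z"] by auto
  then show "cls y = cls z" by (auto simp: in_cls_iff)
qed

lemma Ind_carrier: "carrier Ind = cls ` formal"
  unfolding induced_module_def by (simp add: carrier_FactGroup carrier_free cls_def[abs_def])

lemma cls_closed: "z \<in> formal \<Longrightarrow> cls z \<in> carrier Ind"
  by (simp only: Ind_carrier imageI)

lemma Ind_zero: "\<zero>\<^bsub>Ind\<^esub> = cls 0"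
proof -
  have "\<zero>\<^bsub>Ind\<^esub> = rels" by (simp add: induced_module_def)
  also have "\<dots> = cls 0" by (auto simp: in_cls_iff)
  finally show ?thesis .
qed

lemma Ind_add: "cls y \<oplus>\<^bsub>Ind\<^esub> cls z = cls (y + z)"
proof -
  have "cls y \<oplus>\<^bsub>Ind\<^esub> cls z = (\<Union>a\<in>cls y. \<Union>b\<in>cls z. {a + b})"
    by (simp add: induced_module_def set_mult_def tensor_free_def)
  also have "\<dots> = {a + b | a b. a - y \<in> rels \<and> b - z \<in> rels}"
    unfolding in_cls_iff[symmetric] by blast
  also have "\<dots> = cls (y + z)"
  proof (intro Set.set_eqI iffI)
    fix x assume "x \<in> {a + b | a b. a - y \<in> rels \<and> b - z \<in> rels}"
    then obtain a b where "x = a + b" "a - y \<in> rels" "b - z \<in> rels" by blast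
    then show "x \<in> cls (y + z)"
      using rels_add[of "a - y" "b - z"] by (simp add: in_cls_iff algebra_simps)
  next
    fix x assume "x \<in> cls (y + z)"
    then have "(x - z) - y \<in> rels" "z - z \<in> rels" using rels_zero
      by (auto simp: in_cls_iff algebra_simps)
    moreover have "x = (x - z) + z" by simp
    ultimately show "x \<in> {a + b | a b. a - y \<in> rels \<and> b - z \<in> rels}" by blast
  qed
  finally show ?thesis .
qed

definition lmul :: "'h2 \<Rightarrow> ('h2 \<times> 'v \<Rightarrow>\<^sub>0 int) \<Rightarrow> ('h2 \<times> 'v \<Rightarrow>\<^sub>0 int)" where
  "lmul h = frag_extend (\<lambda>(a, v). frag_of (h * a, v))"

lemma lmul_simps:
  "lmul h 0 = 0" "lmul h (frag_of (a, v)) = frag_of (h * a, v)" "lmul h (- x) = - lmul h x"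
  "lmul h (x + y) = lmul h x + lmul h y" "lmul h (x - y) = lmul h x - lmul h y"
  by (simp_all add: lmul_def frag_extend_add frag_extend_minus frag_extend_diff)

lemma lmul_formal: "z \<in> formal \<Longrightarrow> lmul h z \<in> formal"
  using keys_frag_extend[of "\<lambda>(a, v). frag_of (h * a, v)" z]
    by (fastforce simp: lmul_def formal_def)

lemma lmul_generators:
  assumes "x \<in> generators" shows "lmul h x \<in> generators"
  using assms unfolding generators_def
  by (elim UnE CollectE exE conjE; hypsubst; simp only: lmul_simps distrib_left
      mult.assoc[symmetric]) blast+

lemma lmul_rels: "x \<in> rels \<Longrightarrow> lmul h x \<in> rels"
proof (induction rule: rels_induct)
  case (incl x)
  then show ?case using lmul_generators generate.incl unfolding rels_eq by metis
next
  case (minus x)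
  then have "lmul h x \<in> rels" using lmul_generators generate.incl unfolding rels_eq by metis
  then show ?case by (simp add: lmul_simps rels_minus)
qed (simp_all add: lmul_simps rels_zero rels_add)

text \<open>\<open>induced_module\<close> forms a union over all representatives of a class;
  multiplication preserves the relations, so all members of the union are the same class.\<close>

lemma Ind_smult: "h \<odot>\<^bsub>Ind\<^esub> cls z = cls (lmul h z)"
proof -
  have "h \<odot>\<^bsub>Ind\<^esub> cls z = (\<Union>y\<in>cls z. cls (lmul h y))"
    by (simp add: induced_module_def cls_def lmul_def)
  moreover have "cls (lmul h y) = cls (lmul h z)" if "y \<in> cls z" for y
    using lmul_rels[of "y - z" h] that by (simp add: in_cls_iff cls_eq_iff lmul_simps)
  moreover have "z \<in> cls z" by (simp add: in_cls_iff rels_zero)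
  ultimately show ?thesis by blast
qed

lemma tensor_eq: "tensor \<iota> M a v = cls (frag_of (a, v))"
  by (simp add: tensor_def cls_def)

lemma tensor_closed: "v \<in> carrier M \<Longrightarrow> tensor \<iota> M a v \<in> carrier Ind"
  unfolding tensor_eq by (rule cls_closed) (simp only: formal_simps)

lemma tensor_add_left:
  assumes "v \<in> carrier M"
  shows "tensor \<iota> M (a + b) v = tensor \<iota> M a v \<oplus>\<^bsub>Ind\<^esub> tensor \<iota> M b v"
proof -
  have "frag_of (a + b, v) - frag_of (a, v) - frag_of (b, v) \<in> rels"
    unfolding rels_eq generators_def using assms by (intro generate.incl) blast
  then show ?thesis by (simp add: tensor_eq Ind_add cls_eq_iff diff_diff_eq)
qed

lemma tensor_add_right:
  assumes "u \<in> carrier M" "v \<in> carrier M"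
  shows "tensor \<iota> M a (u \<oplus> v) = tensor \<iota> M a u \<oplus>\<^bsub>Ind\<^esub> tensor \<iota> M a v"
proof -
  have "frag_of (a, u \<oplus> v) - frag_of (a, u) - frag_of (a, v) \<in> rels"
    unfolding rels_eq generators_def using assms by (intro generate.incl) blast
  then show ?thesis by (simp add: tensor_eq Ind_add cls_eq_iff diff_diff_eq)
qed

lemma tensor_balanced:
  assumes "v \<in> carrier M" shows "tensor \<iota> M (a * \<iota> h) v = tensor \<iota> M a (h \<odot> v)"
proof -
  have "frag_of (a * \<iota> h, v) - frag_of (a, h \<odot> v) \<in> rels"
    unfolding rels_eq generators_def using assms by (intro generate.incl) blast
  then show ?thesis by (simp add: tensor_eq cls_eq_iff)
qed

lemma smult_tensor: "h \<odot>\<^bsub>Ind\<^esub> tensor \<iota> M a v = tensor \<iota> M (h * a) v"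
  by (simp add: tensor_eq Ind_smult lmul_simps)

lemma abelian_group_Ind: "abelian_group Ind"
proof (rule abelian_groupI)
  fix X assume "X \<in> carrier Ind"
  then obtain x where x: "x \<in> formal" "X = cls x" by (auto simp: Ind_carrier)
  show "\<exists>Y\<in>carrier Ind. Y \<oplus>\<^bsub>Ind\<^esub> X = \<zero>\<^bsub>Ind\<^esub>"
    by (rule bexI[OF _ cls_closed[OF formal_simps(5)[OF x(1)]]]) (simp add: x(2) Ind_add Ind_zero)
qed (auto simp: Ind_carrier Ind_add Ind_zero ac_simps formal_simps intro!: imageI)

text \<open>Add the additivity relations for \<open>a + - a\<close> and for \<open>0 + 0\<close>:
  the symbols with first entry 0 cancel. Negatives of pure tensors are therefore pure tensors, and
  the induction on the tensor product requires no case for negation.\<close>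

lemma cls_minus_tensor: "v \<in> carrier M \<Longrightarrow> cls (- frag_of (a, v)) = tensor \<iota> M (- a) v"
proof -
  assume v: "v \<in> carrier M"
  have gen: "frag_of (a + b, v) - frag_of (a, v) - frag_of (b, v) \<in> rels" for a b
    unfolding rels_eq generators_def using v by (intro generate.incl) blast
  have "frag_of (a + - a, v) - frag_of (a, v) - frag_of (- a, v) +
      (frag_of (0 + 0, v) - frag_of (0, v) - frag_of (0, v)) = - frag_of (a, v) - frag_of (- a, v)"
    by simp
  then show ?thesis using rels_add[OF gen[of a "- a"] gen[of 0 0]]
    by (simp add: tensor_eq cls_eq_iff)
qed

lemma Ind_induct [consumes 1, case_names zero tensor add]:
  assumes "X \<in> carrier Ind" and zero: "P \<zero>\<^bsub>Ind\<^esub>"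
    and tensor: "\<And>a v. v \<in> carrier M \<Longrightarrow> P (tensor \<iota> M a v)"
    and add: "\<And>X Y. \<lbrakk>X \<in> carrier Ind; Y \<in> carrier Ind; P X; P Y\<rbrakk> \<Longrightarrow> P (X \<oplus>\<^bsub>Ind\<^esub> Y)"
  shows "P X"
proof -
  obtain z where z: "z \<in> formal" "X = cls z" using assms(1) by (auto simp: Ind_carrier)
  from z(1) have "Poly_Mapping.keys z \<subseteq> UNIV \<times> carrier M" by (simp add: formal_def)
  \<comment> \<open>\<open>frag_induction\<close> builds elements by differences, so the claim is
    carried for \<open>z\<close> and \<open>- z\<close> together, which replaces differences by
    sums.\<close>
  then have "z \<in> formal \<and> P (cls z) \<and> P (cls (- z))"
  proof (induction z rule: frag_induction)
    case zero
    show ?case using assms(2) by (simp add: Ind_zero formal_simps)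
  next
    case (diff x y)
    then have "P (cls x \<oplus>\<^bsub>Ind\<^esub> cls (- y))" "P (cls (- x) \<oplus>\<^bsub>Ind\<^esub> cls y)"
      by (simp_all add: add cls_closed formal_simps)
    then show ?case using diff by (simp add: Ind_add formal_simps)
  next
    case (one p)
    then obtain a v where p: "p = (a, v)" "v \<in> carrier M" by (cases p) auto
    then show ?case using tensor by (simp add: cls_minus_tensor tensor_eq[symmetric] formal_simps)
  qed
  then show ?thesis using z by simp
qed

lemma left_module_Ind: "left_module Ind"
proof -
  interpret I: abelian_group Ind by (rule abelian_group_Ind)
  have closed: "h \<odot>\<^bsub>Ind\<^esub> X \<in> carrier Ind" if "X \<in> carrier Ind" for h X
    using that by (auto simp: Ind_carrier Ind_smult intro!: imageI lmul_formal)
  have add_right: "h \<odot>\<^bsub>Ind\<^esub> (X \<oplus>\<^bsub>Ind\<^esub> Y) = h \<odot>\<^bsub>Ind\<^esub> X \<oplus>\<^bsub>Ind\<^esub> h \<odot>\<^bsub>Ind\<^esub> Y"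
    if "X \<in> carrier Ind" "Y \<in> carrier Ind" for h X Y
    using that by (auto simp: Ind_carrier Ind_smult Ind_add lmul_simps)
  have smult_zero: "h \<odot>\<^bsub>Ind\<^esub> \<zero>\<^bsub>Ind\<^esub> = \<zero>\<^bsub>Ind\<^esub>" for h
    by (simp add: Ind_zero Ind_smult lmul_simps)
  show ?thesis
  proof
    show "(h + k) \<odot>\<^bsub>Ind\<^esub> X = h \<odot>\<^bsub>Ind\<^esub> X \<oplus>\<^bsub>Ind\<^esub> k \<odot>\<^bsub>Ind\<^esub> X" if "X \<in> carrier Ind" for h k X
      using that
    proof (induction rule: Ind_induct)
      case (add X Y)
      then show ?case by (simp add: add_right closed I.a_ac)
    qed (simp_all add: smult_zero smult_tensor distrib_right tensor_add_left)
    show "(h * k) \<odot>\<^bsub>Ind\<^esub> X = h \<odot>\<^bsub>Ind\<^esub> (k \<odot>\<^bsub>Ind\<^esub> X)" if "X \<in> carrier Ind" for h k X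
      using that
      by (induction rule: Ind_induct) (simp_all add: smult_zero smult_tensor mult.assoc add_right
          closed)
    show "1 \<odot>\<^bsub>Ind\<^esub> X = X" if "X \<in> carrier Ind" for X
      using that by (induction rule: Ind_induct) (simp_all add: smult_zero smult_tensor add_right)
  qed (simp_all add: closed add_right)
qed

text \<open>The map on the free abelian group vanishes on the three kinds of generators, hence on
  the relations. Complex values suffice because pairings are built one argument at a time.\<close>

lemma tensor_universal:
  fixes \<beta> :: "'h2 \<Rightarrow> 'v \<Rightarrow> complex"
  assumes add_left: "\<And>a b v. v \<in> carrier M \<Longrightarrow> \<beta> (a + b) v = \<beta> a v + \<beta> b v"
    and add_right: "\<And>a u v. \<lbrakk>u \<in> carrier M; v \<in> carrier M\<rbrakk> \<Longrightarrow> \<beta> a (u \<oplus> v) = \<beta> a u + \<beta> a v"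
    and balanced: "\<And>a h v. v \<in> carrier M \<Longrightarrow> \<beta> (a * \<iota> h) v = \<beta> a (h \<odot> v)"
  shows "\<exists>\<Phi>. (\<forall>X\<in>carrier Ind. \<forall>Y\<in>carrier Ind. \<Phi> (X \<oplus>\<^bsub>Ind\<^esub> Y) = \<Phi> X + \<Phi> Y) \<and>
    (\<forall>a. \<forall>v\<in>carrier M. \<Phi> (tensor \<iota> M a v) = \<beta> a v)"
proof -
  let ?C = "\<lparr>carrier = UNIV, monoid.mult = (+), one = 0\<rparr> :: complex monoid"
  have "comm_group ?C"
    by (rule comm_groupI) (auto simp: algebra_simps intro: exI[of _ "- x" for x])
  then obtain g where g: "g \<in> hom (free_Abelian_group (UNIV \<times> carrier M)) ?C"
      "\<And>p. p \<in> UNIV \<times> carrier M \<Longrightarrow> g (frag_of p) = (case p of (a, v) \<Rightarrow> \<beta> a v)"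
    using comm_group.free_Abelian_group_universal[of ?C "\<lambda>(a, v). \<beta> a v" "UNIV \<times> carrier M"]
    by (metis (no_types, lifting) UNIV_I partial_object.select_convs(1) subsetI)
  have g_add: "g (x + y) = g x + g y" if "x \<in> formal" "y \<in> formal" for x y
    using g(1) that by (simp add: hom_def formal_def)
  have g_diff: "g (x - y) = g x - g y" if "x \<in> formal" "y \<in> formal" for x y
    using g_add[of "x - y" y] formal_simps(4)[OF that] that by simp
  have g_zero: "g 0 = 0" using g_diff[OF formal_simps(1,1)] by simp
  have g_minus: "g (- x) = - g x" if "x \<in> formal" for x
    using g_diff[OF formal_simps(1) that] by (simp add: g_zero)
  have g_frag: "g (frag_of (a, v)) = \<beta> a v" if "v \<in> carrier M" for a v
    using g(2)[of "(a, v)"] that by simp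
  have frag: "frag_of (a, v) \<in> formal" if "v \<in> carrier M" for a v
    using that by (simp only: formal_simps)
  have g_gen: "g x = 0" if "x \<in> generators" for x
    using that unfolding generators_def
    by (elim UnE CollectE exE conjE; hypsubst)
      (simp_all only: g_diff frag formal_simps(4) g_frag a_closed smult_closed
        add_left add_right balanced, simp_all)
  have g_rels: "g x = 0" if "x \<in> rels" for x
    using that
  proof (induction rule: rels_induct)
    case (minus x)
    then have "x \<in> formal" using generators_formal by blast
    then show ?case using g_minus g_gen[OF minus] by simp
  next
    case (add x y)
    then show ?case using g_add[OF rels_formal rels_formal] by simp
  qed (simp_all add: g_zero g_gen)
  \<comment> \<open>The value is read off from an arbitrary formal representative;
    \<open>g_rels\<close> makes it independent of the choice.\<close>
  define \<Phi> where "\<Phi> X = g (SOME z. z \<in> formal \<and> X = cls z)" for X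
  have \<Phi>: "\<Phi> (cls z) = g z" if z: "z \<in> formal" for z
  proof -
    let ?y = "SOME y. y \<in> formal \<and> cls z = cls y"
    have y: "?y \<in> formal \<and> cls z = cls ?y" by (rule someI[of _ z]) (use z in blast)
    then have "g (z - ?y) = 0" using g_rels by (simp only: cls_eq_iff)
    then show ?thesis using g_diff[OF z conjunct1[OF y]] by (simp add: \<Phi>_def)
  qed
  have "\<Phi> (X \<oplus>\<^bsub>Ind\<^esub> Y) = \<Phi> X + \<Phi> Y"
    if XY: "X \<in> carrier Ind" "Y \<in> carrier Ind" for X Y
  proof -
    obtain x y where "x \<in> formal" "X = cls x" "y \<in> formal" "Y = cls y"
      using XY by (auto simp: Ind_carrier)
    then show ?thesis using formal_simps(3) by (simp only: Ind_add \<Phi> g_add)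
  qed
  moreover have "\<Phi> (tensor \<iota> M a v) = \<beta> a v" if "v \<in> carrier M" for a v
    unfolding tensor_eq by (simp only: \<Phi> frag[OF that] g_frag[OF that])
  ultimately show ?thesis by blast
qed

end

section \<open>Frobenius extensions with star operations\<close>

text \<open>This isolates what the duality argument uses of the Hecke algebras. The families
  \<open>a\<close> and \<open>b\<close> are dual bases for \<open>E\<close>: the left expansion
  yields injectivity of the pairing map, the right expansion surjectivity.\<close>

locale star_frobenius_extension =
  fixes \<iota> :: "'h1::complex_algebra_1 \<Rightarrow> 'h2::complex_algebra_1"
    and star1 :: "'h1 \<Rightarrow> 'h1" and star2 :: "'h2 \<Rightarrow> 'h2" and E :: "'h2 \<Rightarrow> 'h1"
    and J :: "'j set" and a b :: "'j \<Rightarrow> 'h2"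
  assumes hom_iota: "algebra_hom \<iota>"
    and star1: "conj_linear_antiautomorphism star1" and star2: "conj_linear_antiautomorphism star2"
    and star1_star1: "star1 (star1 h) = h" and star2_star2: "star2 (star2 k) = k"
    and star2_iota: "star2 (\<iota> h) = \<iota> (star1 h)"
    and E_add: "E (k + k') = E k + E k'"
    and E_left: "E (\<iota> h * k) = h * E k" and E_right: "E (k * \<iota> h) = E k * h"
    and finite_J: "finite J"
    and left_expansion: "k = (\<Sum>j\<in>J. a j * \<iota> (E (b j * k)))"
    and right_expansion: "k = (\<Sum>j\<in>J. \<iota> (E (k * a j)) * b j)"

lemma conj_linear_antiautomorphism_simps:
  assumes "conj_linear_antiautomorphism \<sigma>"
  shows "\<sigma> 1 = 1" "\<sigma> (a + b) = \<sigma> a + \<sigma> b" "\<sigma> (a * b) = \<sigma> b * \<sigma> a" "\<sigma> (c *\<^sub>C a) = cnj c *\<^sub>C \<sigma> a"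
  using assms by (auto simp: conj_linear_antiautomorphism_def)

lemma scaleC_eq_mult: "(c *\<^sub>C 1) * a = c *\<^sub>C a" "a * (c *\<^sub>C 1) = c *\<^sub>C (a :: 'a::complex_algebra_1)"
  by (simp_all add: mult_scaleC_left mult_scaleC_right)

section \<open>Hermitian duals of modules over a complex algebra\<close>

locale complex_left_module = left_module M
  for M :: "('h::complex_algebra_1, 'v) module" (structure) +
  fixes star :: "'h \<Rightarrow> 'h"
  assumes star: "conj_linear_antiautomorphism star"
begin

lemmas star_simps = conj_linear_antiautomorphism_simps[OF star]

abbreviation Dual :: "('h, 'v \<Rightarrow> complex) module" where
  "Dual \<equiv> hermitian_dual star M"

lemma Dual_carrier_iff:
  "\<mu> \<in> carrier Dual \<longleftrightarrow> \<mu> \<in> extensional (carrier M) \<and>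
     (\<forall>u\<in>carrier M. \<forall>v\<in>carrier M. \<mu> (u \<oplus> v) = \<mu> u + \<mu> v) \<and>
     (\<forall>c. \<forall>v\<in>carrier M. \<mu> ((c *\<^sub>C 1) \<odot> v) = cnj c * \<mu> v)"
  by (simp add: hermitian_dual_def)

lemma Dual_add: "v \<in> carrier M \<Longrightarrow> (\<mu> \<oplus>\<^bsub>Dual\<^esub> \<nu>) v = \<mu> v + \<nu> v"
  and Dual_zero: "v \<in> carrier M \<Longrightarrow> \<zero>\<^bsub>Dual\<^esub> v = 0"
  and Dual_smult: "v \<in> carrier M \<Longrightarrow> (h \<odot>\<^bsub>Dual\<^esub> \<mu>) v = \<mu> (star h \<odot> v)"
  by (simp_all add: hermitian_dual_def)

lemma Dual_extensional:
  "\<mu> \<oplus>\<^bsub>Dual\<^esub> \<nu> \<in> extensional (carrier M)" "\<zero>\<^bsub>Dual\<^esub> \<in> extensional (carrier M)"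
  "h \<odot>\<^bsub>Dual\<^esub> \<mu> \<in> extensional (carrier M)"
  by (simp_all add: hermitian_dual_def)

lemma Dual_eqI:
  assumes "\<mu> \<in> extensional (carrier M)" "\<nu> \<in> extensional (carrier M)"
    and "\<And>v. v \<in> carrier M \<Longrightarrow> \<mu> v = \<nu> v"
  shows "\<mu> = \<nu>"
  by (rule extensionalityI[OF assms])

lemma DualD:
  assumes "\<mu> \<in> carrier Dual"
  shows "\<mu> \<in> extensional (carrier M)"
    and "\<And>u v. \<lbrakk>u \<in> carrier M; v \<in> carrier M\<rbrakk> \<Longrightarrow> \<mu> (u \<oplus> v) = \<mu> u + \<mu> v"
    and "\<And>c v. v \<in> carrier M \<Longrightarrow> \<mu> ((c *\<^sub>C 1) \<odot> v) = cnj c * \<mu> v"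
  using assms by (auto simp: Dual_carrier_iff)

lemma Dual_at_zero: "\<mu> \<in> carrier Dual \<Longrightarrow> \<mu> \<zero> = 0"
  using DualD(2)[of \<mu> \<zero> \<zero>] by simp

lemma smult_scaleC: "v \<in> carrier M \<Longrightarrow> h \<odot> ((c *\<^sub>C 1) \<odot> v) = (c *\<^sub>C 1) \<odot> (h \<odot> v)"
  by (simp add: smult_assoc[symmetric] scaleC_eq_mult)

lemma Dual_closed:
  "\<mu> \<in> carrier Dual \<Longrightarrow> \<nu> \<in> carrier Dual \<Longrightarrow> \<mu> \<oplus>\<^bsub>Dual\<^esub> \<nu> \<in> carrier Dual"
  "\<zero>\<^bsub>Dual\<^esub> \<in> carrier Dual"
  "\<mu> \<in> carrier Dual \<Longrightarrow> h \<odot>\<^bsub>Dual\<^esub> \<mu> \<in> carrier Dual"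
  unfolding Dual_carrier_iff
  by (auto simp: Dual_extensional Dual_add Dual_zero Dual_smult smult_closed smult_add_right
      smult_scaleC algebra_simps)

lemma left_module_Dual: "left_module Dual"
proof -
  have "abelian_group Dual"
  proof (rule abelian_groupI)
    fix \<mu> assume \<mu>: "\<mu> \<in> carrier Dual"
    let ?\<nu> = "\<lambda>v\<in>carrier M. - \<mu> v"
    have "?\<nu> \<in> carrier Dual"
      using DualD[OF \<mu>] by (simp add: Dual_carrier_iff smult_closed)
    moreover have "?\<nu> \<oplus>\<^bsub>Dual\<^esub> \<mu> = \<zero>\<^bsub>Dual\<^esub>"
      by (rule Dual_eqI) (simp_all add: Dual_extensional Dual_add Dual_zero)
    ultimately show "\<exists>\<nu>\<in>carrier Dual. \<nu> \<oplus>\<^bsub>Dual\<^esub> \<mu> = \<zero>\<^bsub>Dual\<^esub>" by blast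
  qed (auto intro!: Dual_eqI simp: Dual_closed Dual_extensional Dual_add Dual_zero DualD(1))
  then interpret D: abelian_group Dual .
  show ?thesis
    by standard
      (auto intro!: Dual_eqI simp: Dual_closed Dual_extensional Dual_add Dual_smult DualD
        star_simps smult_closed smult_add_left smult_assoc smult_one)
qed

end

context star_frobenius_extension
begin

lemmas iota_simps = algebra_hom_simps[OF hom_iota]
lemmas star_simps = conj_linear_antiautomorphism_simps[OF star1]
  conj_linear_antiautomorphism_simps[OF star2]

lemma iota_scaleC: "\<iota> (c *\<^sub>C 1) = c *\<^sub>C 1"
  by (simp add: iota_simps)

lemma E_scaleC: "E (c *\<^sub>C k) = c *\<^sub>C E k"
  using E_left[of "c *\<^sub>C 1" k] by (simp add: iota_scaleC scaleC_eq_mult)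

lemma star2_sum: "star2 (sum g A) = (\<Sum>i\<in>A. star2 (g i))"
  by (rule additive.sum) (simp add: additive_def star_simps)

text \<open>Expand \<open>star2 k\<close> and apply \<open>star2\<close>: the order of the factors
  is reversed, so coefficients from \<open>\<iota>\<close> move to the right, where they can cross
  the tensor sign.\<close>

lemma star_right_expansion: "k = (\<Sum>j\<in>J. star2 (b j) * \<iota> (star1 (E (star2 k * a j))))"
proof -
  have "k = star2 (\<Sum>j\<in>J. \<iota> (E (star2 k * a j)) * b j)"
    by (simp add: star2_star2 flip: right_expansion)
  then show ?thesis by (simp add: star2_sum star_simps star2_iota)
qed

end

lemma additive_zero:
  assumes "abelian_group G" "\<And>x y. \<lbrakk>x \<in> carrier G; y \<in> carrier G\<rbrakk> \<Longrightarrow> g (x \<oplus>\<^bsub>G\<^esub> y) = g x + g y"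
  shows "g \<zero>\<^bsub>G\<^esub> = (0::complex)"
proof -
  interpret abelian_group G by fact
  show ?thesis using assms(2)[of "\<zero>\<^bsub>G\<^esub>" "\<zero>\<^bsub>G\<^esub>"] by simp
qed

lemma additive_finsum:
  assumes "abelian_group G" "\<And>x y. \<lbrakk>x \<in> carrier G; y \<in> carrier G\<rbrakk> \<Longrightarrow> g (x \<oplus>\<^bsub>G\<^esub> y) = g x + g y"
    and "finite A" "\<And>i. i \<in> A \<Longrightarrow> t i \<in> carrier G"
  shows "g (\<Oplus>\<^bsub>G\<^esub>i\<in>A. t i) = (\<Sum>i\<in>A. g (t i) :: complex)"
proof -
  interpret abelian_group G by fact
  show ?thesis
    using assms(3,4)
    by (induction A rule: finite_induct) (auto simp: additive_zero[OF assms(1,2)] assms(2) Pi_def)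
qed

section \<open>Construction of the pairing between the induced modules\<close>

locale frobenius_module = star_frobenius_extension \<iota> star1 star2 E J a b +
  M: complex_left_module M star1
  for \<iota> :: "'h1::complex_algebra_1 \<Rightarrow> 'h2::complex_algebra_1"
    and star1 star2 E and J :: "'j set" and a b and M :: "('h1, 'v) module"
begin

sublocale V: induction_data M \<iota> ..

sublocale VD: left_module M.Dual by (rule M.left_module_Dual)

sublocale D: induction_data M.Dual \<iota> ..

sublocale VI: complex_left_module V.Ind star2
  by (intro complex_left_module.intro complex_left_module_axioms.intro V.left_module_Ind star2)

sublocale DI: left_module D.Ind by (rule D.left_module_Ind)

abbreviation induced_pairing :: "(('h2 \<times> ('v \<Rightarrow> complex) \<Rightarrow>\<^sub>0 int) set \<Rightarrow> ('h2 \<times> 'v \<Rightarrow>\<^sub>0 int) set \<Rightarrow>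
    complex) \<Rightarrow> bool" where
  "induced_pairing \<equiv> is_induced_pairing \<iota> star1 star2 E M"

abbreviation dtensor where "dtensor \<equiv> tensor \<iota> M.Dual"
abbreviation vtensor where "vtensor \<equiv> tensor \<iota> M"

text \<open>Only the additive part of sesquilinearity, with no condition outside the carriers. This
  already determines values on the carriers from pure tensors; scalars are handled afterwards
  through the module action.\<close>

definition biadditive :: "(('h2 \<times> ('v \<Rightarrow> complex) \<Rightarrow>\<^sub>0 int) set \<Rightarrow> ('h2 \<times> 'v \<Rightarrow>\<^sub>0 int) set \<Rightarrow> complex)
    \<Rightarrow> bool" where
  "biadditive B \<longleftrightarrow>
     (\<forall>\<xi>\<in>carrier D.Ind. \<forall>\<xi>'\<in>carrier D.Ind. \<forall>\<eta>\<in>carrier V.Ind. B (\<xi> \<oplus>\<^bsub>D.Ind\<^esub> \<xi>') \<eta> = B \<xi> \<eta> + B \<xi>' \<eta>) \<and>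
     (\<forall>\<xi>\<in>carrier D.Ind. \<forall>\<eta>\<in>carrier V.Ind. \<forall>\<eta>'\<in>carrier V.Ind. B \<xi> (\<eta> \<oplus>\<^bsub>V.Ind\<^esub> \<eta>') = B \<xi> \<eta> + B \<xi> \<eta>')"

lemma biadditive_zero:
  assumes "biadditive B"
  shows "\<eta> \<in> carrier V.Ind \<Longrightarrow> B \<zero>\<^bsub>D.Ind\<^esub> \<eta> = 0" "\<xi> \<in> carrier D.Ind \<Longrightarrow> B \<xi> \<zero>\<^bsub>V.Ind\<^esub> = 0"
  using additive_zero[OF D.abelian_group_Ind, of "\<lambda>\<xi>. B \<xi> \<eta>"]
    additive_zero[OF V.abelian_group_Ind, of "B \<xi>"] assms unfolding biadditive_def by auto

lemma biadditive_eqI: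
  assumes B: "biadditive B" "biadditive B'"
    and eq: "\<And>k \<mu> l v. \<lbrakk>\<mu> \<in> carrier M.Dual; v \<in> carrier M\<rbrakk> \<Longrightarrow>
      B (dtensor k \<mu>) (vtensor l v) = B' (dtensor k \<mu>) (vtensor l v)"
    and "\<xi> \<in> carrier D.Ind" "\<eta> \<in> carrier V.Ind"
  shows "B \<xi> \<eta> = B' \<xi> \<eta>"
  using assms(4)
proof (induction \<xi> rule: D.Ind_induct)
  case (tensor k \<mu>)
  show ?case
    using assms(5)
  proof (induction \<eta> rule: V.Ind_induct)
    case (add X Y)
    then show ?case using B D.tensor_closed[OF tensor] unfolding biadditive_def by simp
  qed (use B tensor in \<open>simp_all add: biadditive_zero D.tensor_closed eq\<close>)
next
  case (add X Y)
  then show ?case using B assms(5) unfolding biadditive_def by simp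
qed (use B assms(5) in \<open>simp_all add: biadditive_zero\<close>)

text \<open>The universal property is applied first in the left, then in the right argument.\<close>

lemma biadditive_pairing_exists:
  "\<exists>B. biadditive B \<and> (\<forall>k l. \<forall>\<mu>\<in>carrier M.Dual. \<forall>v\<in>carrier M.
     B (dtensor k \<mu>) (vtensor l v) = (E (star2 l * k) \<odot>\<^bsub>M.Dual\<^esub> \<mu>) v)"
proof -
  define P where "P l v \<Phi> \<longleftrightarrow>
      (\<forall>X\<in>carrier D.Ind. \<forall>Y\<in>carrier D.Ind. \<Phi> (X \<oplus>\<^bsub>D.Ind\<^esub> Y) = \<Phi> X + \<Phi> Y) \<and>
      (\<forall>k. \<forall>\<mu>\<in>carrier M.Dual. \<Phi> (dtensor k \<mu>) = (E (star2 l * k) \<odot>\<^bsub>M.Dual\<^esub> \<mu>) v)" for l v \<Phi>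
  define \<Phi> where "\<Phi> l v = (SOME \<Phi>. P l v \<Phi>)" for l v
  have ex_\<Phi>: "\<exists>\<Phi>. P l v \<Phi>" if v: "v \<in> carrier M" for l v
    unfolding P_def
    by (rule D.tensor_universal)
      (simp_all add: v distrib_left E_add VD.smult_add_left VD.smult_add_right M.Dual_add
        mult.assoc[symmetric] E_right VD.smult_assoc)
  have "P l v (\<Phi> l v)" if "v \<in> carrier M" for l v
    unfolding \<Phi>_def by (rule someI_ex[OF ex_\<Phi>[OF that]])
  then have \<Phi>:
    "\<lbrakk>v \<in> carrier M; X \<in> carrier D.Ind; Y \<in> carrier D.Ind\<rbrakk> \<Longrightarrow>
       \<Phi> l v (X \<oplus>\<^bsub>D.Ind\<^esub> Y) = \<Phi> l v X + \<Phi> l v Y"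
    "\<lbrakk>v \<in> carrier M; \<mu> \<in> carrier M.Dual\<rbrakk> \<Longrightarrow>
       \<Phi> l v (dtensor k \<mu>) = (E (star2 l * k) \<odot>\<^bsub>M.Dual\<^esub> \<mu>) v" for l v X Y k \<mu>
    by (simp_all add: P_def)
  have \<Phi>_zero: "\<Phi> l v \<zero>\<^bsub>D.Ind\<^esub> = 0" if "v \<in> carrier M" for l v
    by (rule additive_zero[OF D.abelian_group_Ind]) (rule \<Phi>(1)[OF that])
  have left: "\<Phi> (l + m) v X = \<Phi> l v X + \<Phi> m v X" if "X \<in> carrier D.Ind" "v \<in> carrier M" for l m v X
    using that(1) by (induction rule: D.Ind_induct)
      (simp_all add: that(2) \<Phi> \<Phi>_zero star_simps distrib_right E_add VD.smult_add_left M.Dual_add)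
  have right: "\<Phi> l (u \<oplus>\<^bsub>M\<^esub> v) X = \<Phi> l u X + \<Phi> l v X"
    if "X \<in> carrier D.Ind" "u \<in> carrier M" "v \<in> carrier M" for l u v X
    using that(1) by (induction rule: D.Ind_induct)
      (simp_all add: that(2,3) \<Phi> \<Phi>_zero M.DualD(2)[OF M.Dual_closed(3)])
  \<comment> \<open>Star turns the right factor \<open>\<iota> h\<close> into the left factor
    \<open>\<iota> (star1 h)\<close>, which leaves \<open>E\<close> as \<open>star1 h\<close>; the
    action on the dual applies \<open>star1\<close> once more and puts \<open>h\<close> on
    \<open>v\<close>.\<close>
  have balanced: "\<Phi> (l * \<iota> h) v X = \<Phi> l (h \<odot>\<^bsub>M\<^esub> v) X"
    if "X \<in> carrier D.Ind" "v \<in> carrier M" for l h v X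
    using that(1) by (induction rule: D.Ind_induct)
      (simp_all add: that(2) \<Phi> \<Phi>_zero M.smult_closed star_simps star2_iota mult.assoc E_left
        M.Dual_smult star1_star1 M.smult_assoc)
  define Q where "Q \<xi> \<Psi> \<longleftrightarrow>
      (\<forall>X\<in>carrier V.Ind. \<forall>Y\<in>carrier V.Ind. \<Psi> (X \<oplus>\<^bsub>V.Ind\<^esub> Y) = \<Psi> X + \<Psi> Y) \<and>
      (\<forall>l. \<forall>v\<in>carrier M. \<Psi> (vtensor l v) = \<Phi> l v \<xi>)" for \<xi> \<Psi>
  define B where "B \<xi> = (SOME \<Psi>. Q \<xi> \<Psi>)" for \<xi>
  have ex_\<Psi>: "\<exists>\<Psi>. Q \<xi> \<Psi>" if \<xi>: "\<xi> \<in> carrier D.Ind" for \<xi>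
    unfolding Q_def by (rule V.tensor_universal) (simp_all add: \<xi> left right balanced)
  have "Q \<xi> (B \<xi>)" if "\<xi> \<in> carrier D.Ind" for \<xi>
    unfolding B_def by (rule someI_ex[OF ex_\<Psi>[OF that]])
  then have B:
    "\<lbrakk>\<xi> \<in> carrier D.Ind; X \<in> carrier V.Ind; Y \<in> carrier V.Ind\<rbrakk> \<Longrightarrow>
       B \<xi> (X \<oplus>\<^bsub>V.Ind\<^esub> Y) = B \<xi> X + B \<xi> Y"
    "\<lbrakk>\<xi> \<in> carrier D.Ind; v \<in> carrier M\<rbrakk> \<Longrightarrow> B \<xi> (vtensor l v) = \<Phi> l v \<xi>" for \<xi> X Y l v
    by (simp_all add: Q_def)
  have B_zero: "B \<xi> \<zero>\<^bsub>V.Ind\<^esub> = 0" if "\<xi> \<in> carrier D.Ind" for \<xi>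
    by (rule additive_zero[OF V.abelian_group_Ind]) (rule B(1)[OF that])
  have "B (\<xi> \<oplus>\<^bsub>D.Ind\<^esub> \<xi>') \<eta> = B \<xi> \<eta> + B \<xi>' \<eta>"
    if "\<eta> \<in> carrier V.Ind" "\<xi> \<in> carrier D.Ind" "\<xi>' \<in> carrier D.Ind" for \<xi> \<xi>' \<eta>
    using that(1) by (induction rule: V.Ind_induct)
      (simp_all add: that(2,3) B B_zero \<Phi>)
  then have "biadditive B" using B(1) by (simp add: biadditive_def)
  moreover have "B (dtensor k \<mu>) (vtensor l v) = (E (star2 l * k) \<odot>\<^bsub>M.Dual\<^esub> \<mu>) v"
    if "\<mu> \<in> carrier M.Dual" "v \<in> carrier M" for k l \<mu> v
    using that by (simp add: B(2) D.tensor_closed \<Phi>(2))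
  ultimately show ?thesis by blast
qed

lemma induced_pairingD:
  assumes "induced_pairing B"
  shows "biadditive B" "B \<in> carrier D.Ind \<rightarrow>\<^sub>E carrier V.Ind \<rightarrow>\<^sub>E UNIV"
    "\<And>k l \<mu> v. \<lbrakk>\<mu> \<in> carrier M.Dual; v \<in> carrier M\<rbrakk> \<Longrightarrow>
      B (dtensor k \<mu>) (vtensor l v) = (E (star2 l * k) \<odot>\<^bsub>M.Dual\<^esub> \<mu>) v"
    "\<And>c \<xi> \<eta>. \<lbrakk>\<xi> \<in> carrier D.Ind; \<eta> \<in> carrier V.Ind\<rbrakk> \<Longrightarrow>
      B \<xi> ((c *\<^sub>C 1) \<odot>\<^bsub>V.Ind\<^esub> \<eta>) = cnj c * B \<xi> \<eta>"
  using assms unfolding is_induced_pairing_def sesquilinear_pairings_def biadditive_def by auto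

text \<open>Besides equivariance, scalars \<open>k\<close> reduce conjugate-linearity on the right to linearity on the
  left.\<close>

lemma biadditive_adjoint:
  assumes B: "biadditive B" and val: "\<And>k l \<mu> v. \<lbrakk>\<mu> \<in> carrier M.Dual; v \<in> carrier M\<rbrakk> \<Longrightarrow>
      B (dtensor k \<mu>) (vtensor l v) = (E (star2 l * k) \<odot>\<^bsub>M.Dual\<^esub> \<mu>) v"
    and "\<xi> \<in> carrier D.Ind" "\<eta> \<in> carrier V.Ind"
  shows "B (k \<odot>\<^bsub>D.Ind\<^esub> \<xi>) \<eta> = B \<xi> (star2 k \<odot>\<^bsub>V.Ind\<^esub> \<eta>)"
proof (rule biadditive_eqI[OF _ _ _ assms(3,4)])
  show "biadditive (\<lambda>\<xi> \<eta>. B (k \<odot>\<^bsub>D.Ind\<^esub> \<xi>) \<eta>)" "biadditive (\<lambda>\<xi> \<eta>. B \<xi> (star2 k \<odot>\<^bsub>V.Ind\<^esub> \<eta>))"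
    using B
      by (simp_all add: biadditive_def DI.smult_add_right VI.smult_add_right DI.smult_closed
          VI.smult_closed)
  fix k' \<mu> l v assume "\<mu> \<in> carrier M.Dual" "v \<in> carrier M"
  then show "B (k \<odot>\<^bsub>D.Ind\<^esub> dtensor k' \<mu>) (vtensor l v) = B (dtensor k' \<mu>) (star2 k \<odot>\<^bsub>V.Ind\<^esub>
      vtensor l v)"
    by (simp add: D.smult_tensor V.smult_tensor val star_simps star2_star2 mult.assoc)
qed

text \<open>The scalar is conjugated twice, once by the star in the action on the dual and once by
  conjugate-linearity of the functional, so it comes out as \<open>c\<close> itself.\<close>

lemma biadditive_scale:
  assumes B: "biadditive B" and val: "\<And>k l \<mu> v. \<lbrakk>\<mu> \<in> carrier M.Dual; v \<in> carrier M\<rbrakk> \<Longrightarrow>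
      B (dtensor k \<mu>) (vtensor l v) = (E (star2 l * k) \<odot>\<^bsub>M.Dual\<^esub> \<mu>) v"
    and "\<xi> \<in> carrier D.Ind" "\<eta> \<in> carrier V.Ind"
  shows "B ((c *\<^sub>C 1) \<odot>\<^bsub>D.Ind\<^esub> \<xi>) \<eta> = c * B \<xi> \<eta>"
proof (rule biadditive_eqI[OF _ _ _ assms(3,4)])
  show "biadditive (\<lambda>\<xi> \<eta>. B ((c *\<^sub>C 1) \<odot>\<^bsub>D.Ind\<^esub> \<xi>) \<eta>)" "biadditive (\<lambda>\<xi> \<eta>. c * B \<xi> \<eta>)"
    using B by (simp_all add: biadditive_def DI.smult_add_right DI.smult_closed distrib_left)
  fix k \<mu> l v assume \<mu>: "\<mu> \<in> carrier M.Dual" and v: "v \<in> carrier M"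
  have "B ((c *\<^sub>C 1) \<odot>\<^bsub>D.Ind\<^esub> dtensor k \<mu>) (vtensor l v) =
      (((c *\<^sub>C 1) * E (star2 l * k)) \<odot>\<^bsub>M.Dual\<^esub> \<mu>) v"
    using \<mu> v by (simp add: D.smult_tensor val scaleC_eq_mult mult_scaleC_right E_scaleC)
  also have "\<dots> = c * (E (star2 l * k) \<odot>\<^bsub>M.Dual\<^esub> \<mu>) v"
    using \<mu> v by (simp only: VD.smult_assoc M.Dual_smult[OF v, of "c *\<^sub>C 1"] star_simps
        M.DualD(3)[OF M.Dual_closed(3)] complex_cnj_cnj)
  finally show "B ((c *\<^sub>C 1) \<odot>\<^bsub>D.Ind\<^esub> dtensor k \<mu>) (vtensor l v) = c * B (dtensor k \<mu>) (vtensor l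
      v)"
    using \<mu> v by (simp add: val)
qed

lemma induced_pairing_exists: "\<exists>B. induced_pairing B"
proof -
  obtain B where B: "biadditive B" "\<And>k l \<mu> v. \<lbrakk>\<mu> \<in> carrier M.Dual; v \<in> carrier M\<rbrakk> \<Longrightarrow>
      B (dtensor k \<mu>) (vtensor l v) = (E (star2 l * k) \<odot>\<^bsub>M.Dual\<^esub> \<mu>) v"
    using biadditive_pairing_exists by blast
  \<comment> \<open>\<open>sesquilinear_pairings\<close> demands extensional functions; cutting off
    at the carriers makes uniqueness an equality of functions.\<close>
  let ?B = "\<lambda>\<xi>\<in>carrier D.Ind. \<lambda>\<eta>\<in>carrier V.Ind. B \<xi> \<eta>"
  have cnj: "B \<xi> ((c *\<^sub>C 1) \<odot>\<^bsub>V.Ind\<^esub> \<eta>) = cnj c * B \<xi> \<eta>"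
    if "\<xi> \<in> carrier D.Ind" "\<eta> \<in> carrier V.Ind" for c \<xi> \<eta>
    using biadditive_adjoint[OF B that, of "cnj c *\<^sub>C 1"] biadditive_scale[OF B that, of "cnj c"]
    by (simp add: star_simps)
  have "?B \<in> sesquilinear_pairings D.Ind V.Ind"
    using B(1) biadditive_scale[OF B] cnj
    by (simp add: sesquilinear_pairings_def biadditive_def DI.smult_closed VI.smult_closed)
  then have "induced_pairing ?B"
    using B(2) by (simp add: is_induced_pairing_def D.tensor_closed V.tensor_closed)
  then show ?thesis by blast
qed

lemma induced_pairing_unique:
  assumes "induced_pairing B" "induced_pairing B'" shows "B = B'"
proof -
  note B = induced_pairingD[OF assms(1)] and B' = induced_pairingD[OF assms(2)]
  have eq: "B \<xi> \<eta> = B' \<xi> \<eta>" if "\<xi> \<in> carrier D.Ind" "\<eta> \<in> carrier V.Ind" for \<xi> \<eta>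
    by (rule biadditive_eqI[OF B(1) B'(1) _ that]) (simp add: B(3) B'(3))
  have "B \<xi> = B' \<xi>" if "\<xi> \<in> carrier D.Ind" for \<xi>
    by (rule PiE_ext[OF PiE_mem[OF B(2) that] PiE_mem[OF B'(2) that]]) (rule eq[OF that])
  then show ?thesis by (rule PiE_ext[OF B(2) B'(2)])
qed

lemma induced_pairing_in_dual:
  assumes "induced_pairing B" "\<xi> \<in> carrier D.Ind" shows "B \<xi> \<in> carrier VI.Dual"
  using induced_pairingD[OF assms(1)] assms(2) PiE_mem[OF induced_pairingD(2)[OF assms(1)] assms(2)]
  by (simp add: VI.Dual_carrier_iff biadditive_def PiE_iff)

section \<open>The inverse of the pairing map\<close>

definition component :: "(('h2 \<times> 'v \<Rightarrow>\<^sub>0 int) set \<Rightarrow> complex) \<Rightarrow> 'j \<Rightarrow> 'v \<Rightarrow> complex" where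
  "component \<Lambda> j = (\<lambda>v\<in>carrier M. \<Lambda> (vtensor (star2 (b j)) v))"

definition dual_element :: "(('h2 \<times> 'v \<Rightarrow>\<^sub>0 int) set \<Rightarrow> complex) \<Rightarrow> ('h2 \<times> ('v \<Rightarrow> complex) \<Rightarrow>\<^sub>0 int)
    set" where
  "dual_element \<Lambda> = (\<Oplus>\<^bsub>D.Ind\<^esub>j\<in>J. dtensor (a j) (component \<Lambda> j))"

lemma component_closed:
  assumes "\<Lambda> \<in> carrier VI.Dual" shows "component \<Lambda> j \<in> carrier M.Dual"
proof -
  have "vtensor k ((c *\<^sub>C 1) \<odot>\<^bsub>M\<^esub> v) = (c *\<^sub>C 1) \<odot>\<^bsub>V.Ind\<^esub> vtensor k v" if "v \<in> carrier M" for k c v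
    using V.tensor_balanced[OF that, of k "c *\<^sub>C 1"]
    by (simp add: iota_scaleC scaleC_eq_mult V.smult_tensor)
  then show ?thesis
    using VI.DualD[OF assms]
    by (simp add: M.Dual_carrier_iff component_def V.tensor_add_right V.tensor_closed
        M.smult_closed)
qed

lemma vtensor_sum:
  assumes v: "v \<in> carrier M" and "\<Lambda> \<in> carrier VI.Dual" "finite A"
  shows "\<Lambda> (vtensor (\<Sum>i\<in>A. k i) v) = (\<Sum>i\<in>A. \<Lambda> (vtensor (k i) v))"
proof -
  have "additive (\<lambda>k. \<Lambda> (vtensor k v))"
    using VI.DualD(2)[OF assms(2)] v by (simp add: additive_def V.tensor_add_left V.tensor_closed)
  then show ?thesis by (rule additive.sum)
qed

text \<open>Evaluation at a pure tensor \<open>k \<otimes> v\<close> yields a sum in which the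
  coefficients \<open>star1 (E (star2 k * a j))\<close> act on \<open>v\<close>. Moved across the
  tensor sign they complete the starred right expansion of \<open>k\<close>.\<close>

lemma pairing_dual_element:
  assumes B: "induced_pairing B" and \<Lambda>: "\<Lambda> \<in> carrier VI.Dual"
  shows "dual_element \<Lambda> \<in> carrier D.Ind" "B (dual_element \<Lambda>) = \<Lambda>"
proof -
  note BD = induced_pairingD[OF B]
  have t: "dtensor (a j) (component \<Lambda> j) \<in> carrier D.Ind" for j
    by (rule D.tensor_closed[OF component_closed[OF \<Lambda>]])
  then show closed: "dual_element \<Lambda> \<in> carrier D.Ind" by (simp add: dual_element_def)
  have dual: "B (dual_element \<Lambda>) \<in> carrier VI.Dual" by (rule induced_pairing_in_dual[OF B closed])
  have eq: "B (dual_element \<Lambda>) \<eta> = \<Lambda> \<eta>" if "\<eta> \<in> carrier V.Ind" for \<eta>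
    using that
  proof (induction rule: V.Ind_induct)
    case (tensor k v)
    let ?e = "\<lambda>j. star1 (E (star2 k * a j))"
    have "B (dual_element \<Lambda>) (vtensor k v) = (\<Sum>j\<in>J. B (dtensor (a j) (component \<Lambda> j)) (vtensor k
        v))"
      unfolding dual_element_def
      using BD(1) V.tensor_closed[OF tensor] t finite_J
      by (intro additive_finsum[where g = "\<lambda>\<xi>. B \<xi> (vtensor k v)"] D.abelian_group_Ind)
        (simp_all add: biadditive_def)
    also have "\<dots> = (\<Sum>j\<in>J. \<Lambda> (vtensor (star2 (b j)) (?e j \<odot>\<^bsub>M\<^esub> v)))"
      using tensor by (simp add: BD(3) component_closed[OF \<Lambda>] M.Dual_smult)
        (simp add: component_def M.smult_closed)
    also have "\<dots> = \<Lambda> (vtensor (\<Sum>j\<in>J. star2 (b j) * \<iota> (?e j)) v)"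
      using tensor by (simp add: vtensor_sum[OF _ \<Lambda> finite_J] V.tensor_balanced)
    finally show ?case by (simp flip: star_right_expansion)
  next
    case (add X Y)
    then show ?case by (simp add: VI.DualD(2)[OF dual] VI.DualD(2)[OF \<Lambda>])
  next
    case zero
    show ?case
      by (simp only: VI.Dual_at_zero[OF dual] VI.Dual_at_zero[OF \<Lambda>])
  qed
  show "B (dual_element \<Lambda>) = \<Lambda>"
    by (rule VI.Dual_eqI[OF VI.DualD(1)[OF dual] VI.DualD(1)[OF \<Lambda>] eq])
qed

lemma component_add:
  assumes "\<Lambda> \<in> carrier VI.Dual" "\<Lambda>' \<in> carrier VI.Dual"
  shows "component (\<Lambda> \<oplus>\<^bsub>VI.Dual\<^esub> \<Lambda>') j = component \<Lambda> j \<oplus>\<^bsub>M.Dual\<^esub> component \<Lambda>' j"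
  by (rule M.Dual_eqI[OF _ M.Dual_extensional(1)])
    (simp_all add: component_def VI.Dual_add M.Dual_add V.tensor_closed)

lemma dual_element_add:
  assumes "\<Lambda> \<in> carrier VI.Dual" "\<Lambda>' \<in> carrier VI.Dual"
  shows "dual_element (\<Lambda> \<oplus>\<^bsub>VI.Dual\<^esub> \<Lambda>') = dual_element \<Lambda> \<oplus>\<^bsub>D.Ind\<^esub> dual_element \<Lambda>'"
proof -
  show ?thesis
    unfolding dual_element_def
    by (simp add: component_add[OF assms] D.tensor_add_right component_closed assms
        D.tensor_closed Pi_def)
qed

lemma induced_pairing_add:
  assumes "induced_pairing B" "\<xi> \<in> carrier D.Ind" "\<xi>' \<in> carrier D.Ind"
  shows "B (\<xi> \<oplus>\<^bsub>D.Ind\<^esub> \<xi>') = B \<xi> \<oplus>\<^bsub>VI.Dual\<^esub> B \<xi>'"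
proof (rule VI.Dual_eqI[OF _ VI.Dual_extensional(1)])
  show "B (\<xi> \<oplus>\<^bsub>D.Ind\<^esub> \<xi>') \<in> extensional (carrier V.Ind)"
    using assms by (intro VI.DualD(1) induced_pairing_in_dual DI.a_closed)
qed (use induced_pairingD(1)[OF assms(1)] assms in \<open>simp add: VI.Dual_add biadditive_def\<close>)

text \<open>For a pure tensor \<open>k \<otimes> \<mu>\<close> the component at \<open>j\<close> is
  \<open>E (b j * k)\<close> acting on \<mu>, as the two stars on \<open>b j\<close> cancel. Moving
  this coefficient across the tensor sign gives the left expansion of \<open>k\<close>.\<close>

lemma dual_element_pairing:
  assumes B: "induced_pairing B" and "\<xi> \<in> carrier D.Ind" shows "dual_element (B \<xi>) = \<xi>"
  using assms(2)
proof (induction rule: D.Ind_induct)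
  case (tensor k \<mu>)
  have "component (B (dtensor k \<mu>)) j = E (b j * k) \<odot>\<^bsub>M.Dual\<^esub> \<mu>" for j
    by (rule M.Dual_eqI[OF _ M.Dual_extensional(3)])
      (simp_all add: component_def induced_pairingD(3)[OF B] tensor star2_star2)
  then have "dual_element (B (dtensor k \<mu>)) = (\<Oplus>\<^bsub>D.Ind\<^esub>j\<in>J. dtensor (a j * \<iota> (E (b j * k))) \<mu>)"
    by (simp add: dual_element_def D.tensor_balanced tensor)
  also have "\<dots> = dtensor (\<Sum>j\<in>J. a j * \<iota> (E (b j * k))) \<mu>"
    using finite_J
  proof (induction J rule: finite_induct)
    case empty
    have "dtensor (0 + 0) \<mu> = dtensor 0 \<mu> \<oplus>\<^bsub>D.Ind\<^esub> dtensor 0 \<mu>"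
      by (rule D.tensor_add_left[OF tensor])
    then show ?case using D.tensor_closed[OF tensor, of 0] DI.add.r_cancel_one' by simp
  next
    case (insert j A)
    then show ?case using tensor by (simp add: D.tensor_add_left D.tensor_closed Pi_def)
  qed
  finally show ?case by (simp flip: left_expansion)
next
  case (add X Y)
  then show ?case
    by (simp add: induced_pairing_add[OF B] dual_element_add induced_pairing_in_dual[OF B])
next
  case zero
  let ?z = "dual_element (B \<zero>\<^bsub>D.Ind\<^esub>)"
  have z: "?z \<in> carrier D.Ind"
    by (rule pairing_dual_element(1)[OF B induced_pairing_in_dual[OF B DI.zero_closed]])
  \<comment> \<open>Additivity makes \<open>?z\<close> equal to its own double, and in a group this
    forces it to be zero.\<close>
  have "?z \<oplus>\<^bsub>D.Ind\<^esub> ?z = dual_element (B (\<zero>\<^bsub>D.Ind\<^esub> \<oplus>\<^bsub>D.Ind\<^esub> \<zero>\<^bsub>D.Ind\<^esub>))"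
    by (simp add: induced_pairing_add[OF B] dual_element_add induced_pairing_in_dual[OF B] del:
        DI.l_zero DI.r_zero)
  then show ?case using z DI.add.r_cancel_one' by simp
qed

theorem induced_pairing_iso:
  assumes B: "induced_pairing B"
  shows "left_module_iso D.Ind VI.Dual B"
proof (intro left_module_iso.intro left_module_iso_axioms.intro D.left_module_Ind
    VI.left_module_Dual)
  show "bij_betw B (carrier D.Ind) (carrier VI.Dual)"
    by (rule bij_betw_byWitness[where f' = dual_element])
      (auto simp: dual_element_pairing[OF B] pairing_dual_element[OF B] induced_pairing_in_dual[OF
          B])
  show "B (\<xi> \<oplus>\<^bsub>D.Ind\<^esub> \<xi>') = B \<xi> \<oplus>\<^bsub>VI.Dual\<^esub> B \<xi>'"
    if "\<xi> \<in> carrier D.Ind" "\<xi>' \<in> carrier D.Ind" for \<xi> \<xi>'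
    by (rule induced_pairing_add[OF B that])
  show "B (k \<odot>\<^bsub>D.Ind\<^esub> \<xi>) = k \<odot>\<^bsub>VI.Dual\<^esub> B \<xi>" if \<xi>: "\<xi> \<in> carrier D.Ind" for k \<xi>
  proof (rule VI.Dual_eqI[OF _ VI.Dual_extensional(3)])
    show "B (k \<odot>\<^bsub>D.Ind\<^esub> \<xi>) \<in> extensional (carrier V.Ind)"
      using \<xi> B by (intro VI.DualD(1) induced_pairing_in_dual DI.smult_closed)
    show "B (k \<odot>\<^bsub>D.Ind\<^esub> \<xi>) \<eta> = (k \<odot>\<^bsub>VI.Dual\<^esub> B \<xi>) \<eta>" if "\<eta> \<in> carrier V.Ind" for \<eta>
      using biadditive_adjoint[OF induced_pairingD(1,3)[OF B] \<xi> that] that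
        by (simp add: VI.Dual_smult)
  qed
qed

end

text \<open>The prescribed formula lives on pure tensors only, so unique existence of a sesquilinear
  pairing expresses its well-definedness; the isomorphism is that pairing, curried.\<close>

theorem theorem5p5:
  fixes D1 :: "('x1::ab_group_add, 'y1::ab_group_add) root_datum"
    and D2 :: "('x2::ab_group_add, 'y2::ab_group_add) root_datum"
    and q :: real
    and lam1 lams1 :: "'x1 \<Rightarrow> real" and lam2 lams2 :: "'x2 \<Rightarrow> real"
    and \<theta>1 :: "'x1 \<Rightarrow> 'h1::complex_algebra_1" and T1 :: "('x1 \<Rightarrow> 'x1) \<Rightarrow> 'h1"
    and \<theta>2 :: "'x2 \<Rightarrow> 'h2::complex_algebra_1" and T2 :: "('x2 \<Rightarrow> 'x2) \<Rightarrow> 'h2"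
    and f :: "'x1 \<Rightarrow> 'x2" and \<iota> :: "'h1 \<Rightarrow> 'h2"
    and star1 :: "'h1 \<Rightarrow> 'h1" and star2 :: "'h2 \<Rightarrow> 'h2"
    and V :: "('h1, 'v) module"
  assumes "hecke_isogeny D1 D2 q lam1 lams1 lam2 lams2 \<theta>1 T1 \<theta>2 T2 f \<iota>"
    and "hecke_star D1 q lam1 lams1 \<theta>1 T1 star1"
    and "hecke_star D2 q lam2 lams2 \<theta>2 T2 star2"
    and "left_module V"
  shows "(\<exists>!B. is_induced_pairing \<iota> star1 star2 (degree_zero_projection D2 \<theta>2 T2 f \<iota>) V B) \<and>
    (\<forall>B. is_induced_pairing \<iota> star1 star2 (degree_zero_projection D2 \<theta>2 T2 f \<iota>) V B \<longrightarrow>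
      left_module_iso (induced_module \<iota> (hermitian_dual star1 V))
        (hermitian_dual star2 (induced_module \<iota> V)) B)"
proof -
  interpret S: star_isogeny D1 D2 q lam1 lams1 lam2 lams2 \<theta>1 T1 \<theta>2 T2 f \<iota> star1 star2
    using assms(1-3) by (intro star_isogeny.intro)
  interpret F: frobenius_module \<iota> star1 star2 S.cond_exp "cokernel f"
    "\<lambda>g. \<theta>2 (S.repr g)" "\<lambda>g. \<theta>2 (- S.repr g)" V
  proof (intro frobenius_module.intro star_frobenius_extension.intro
      complex_left_module.intro complex_left_module_axioms.intro)
    show "left_module V" by fact
  qed (fact S.hom_iota S.S1.star_antiautomorphism S.S2.star_antiautomorphism S.S1.star_star
      S.S2.star_star S.star2_iota S.cond_exp_add S.cond_exp_iota_mult S.cond_exp_mult_iota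
      S.finite_cokernel S.left_expansion S.right_expansion)+
  have E: "degree_zero_projection D2 \<theta>2 T2 f \<iota> = S.cond_exp"
    by (rule ext) (rule S.degree_zero_projection_eq)
  show ?thesis
    unfolding E using F.induced_pairing_exists F.induced_pairing_unique F.induced_pairing_iso
      by blast
qed

end
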